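(* Let $f:\mathbb{R}^n\to\mathbb{R}$, $g:\mathbb{R}^n\to\mathbb{R}^m$, $h:\mathbb{R}^n\to\mathbb{R}^l$ be differentiable with locally Lipschitz derivatives, let $\alpha>0$, and let $\mathcal{G}_\alpha(\theta)$ denote the solution of the quadratic program (QP) given in the context. Suppose that: (A1) the Mangasarian–Fromovitz constraint qualification (MFCQ) holds for (QP) at every $\theta\in\mathbb{R}^n$ (as spelled out in the context); (A2) there exists a unique solution $\theta^*\in\mathbb{R}^n$ to the nonlinear program (NLP) given in the context, and $\theta^*$ is the only point that satisfies the KKT conditions of (NLP) with some Lagrange multipliers $(u^*,v^* )\in\mathbb{R}^m\times\mathbb{R}^l$; (A3) for every $\theta\in\mathbb{R}^n$ there exist $\bar g\in\mathbb{R}^m_{\ge 0}$ and $\bar h\in\mathbb{R}^l_{\ge 0}$ such that the set $\mathcal{C}_{\bar g,\bar h}=\{\vartheta\in\mathbb{R}^n : g(\vartheta)\le\bar g,\ |h(\vartheta)|\le\bar h\}$ (componentwise inequalities and absolute values) is compact and contains $\theta$. Then the dynamics $\dot\theta=\mathcal{G}_\alpha(\theta)$ are globally asymptotically stable with respect to the equilibrium $\theta^*$.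
   Context: Vector inequalities and $|h(\theta)|$ are understood componentwise. The nonlinear program (NLP) is: minimize $f(\theta)$ over $\theta\in\mathbb{R}^n$ subject to $g(\theta)\le 0$ and $h(\theta)=0$. KKT conditions of (NLP) at $\theta$ with multipliers $(u,v)\in\mathbb{R}^m\times\mathbb{R}^l$: $\nabla f(\theta)+\frac{\partial g(\theta)}{\partial\theta}^\top u+\frac{\partial h(\theta)}{\partial\theta}^\top v=0$, $g(\theta)\le 0$, $h(\theta)=0$, $u\ge 0$, $u^\top g(\theta)=0$. For $\alpha>0$ the safe gradient flow is $\dot\theta=\mathcal{G}_\alpha(\theta)$, where $$\text{(QP)}\qquad \mathcal{G}_\alpha(\theta)=\arg\min_{\xi\in\mathbb{R}^n}\ \tfrac12\|\xi+\nabla f(\theta)\|^2\quad\text{subject to}\quad \frac{\partial g(\theta)}{\partial\theta}\,\xi\le-\alpha g(\theta),\quad \frac{\partial h(\theta)}{\partial\theta}\,\xi=-\alpha h(\theta).$$ MFCQ for (QP) at every $\theta\in\mathbb{R}^n$ means: for each $\theta\in\mathbb{R}^n$, with $\xi^*$ denoting the optimal point of (QP) at $\theta$ (its existence is understood as part of the condition), (1) $\frac{\partial h(\theta)}{\partial\theta}$ has full row rank, and (2) there exists $d\in\mathbb{R}^n$ such that $\nabla h_j(\theta)^\top d=0$ for all $j=1,\dots,l$ and $\nabla g_i(\theta)^\top d<0$ for all $i\in\mathcal{A}_{\mathrm{QP}}(\theta):=\{i\in\{1,\dots,m\} : \nabla g_i(\theta)^\top\xi^*+\alpha g_i(\theta)=0\}$.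 *)

theory Defs
  imports "HOL-Analysis.Analysis"
begin

text \<open>
  The constraint maps into \<open>m\<close>- and \<open>l\<close>-dimensional space are given by their components
  \<open>g i\<close> for \<open>i \<in> {1..m}\<close> and \<open>h j\<close> for \<open>j \<in> {1..l}\<close> (values of \<open>g\<close>, \<open>h\<close> at other
  indices are irrelevant), so that problems without inequality constraints (\<open>m = 0\<close>) or without
  equality constraints (\<open>l = 0\<close>) are included. The rows of the Jacobians are the gradients of the
  components.
\<close>

definition grad :: "(real ^ 'n \<Rightarrow> real) \<Rightarrow> real ^ 'n \<Rightarrow> real ^ 'n" where
  "grad \<phi> x = (THE D. GDERIV \<phi> x :> D)"

text \<open>
  The library predicate \<^const>\<open>local_lipschitz\<close> is about time-dependent maps; here the map does
  not depend on time. A vector-valued map has a locally Lipschitz derivative iff each of its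
  finitely many components has a locally Lipschitz gradient.
\<close>

definition diff_loc_lipschitz_deriv :: "(real ^ 'n \<Rightarrow> real) \<Rightarrow> bool" where
  "diff_loc_lipschitz_deriv \<phi> \<longleftrightarrow>
     (\<forall>x. \<phi> differentiable (at x)) \<and>
     local_lipschitz (UNIV :: real set) UNIV (\<lambda>_. grad \<phi>)"

definition nlp_feasible ::
  "nat \<Rightarrow> (nat \<Rightarrow> real ^ 'n \<Rightarrow> real) \<Rightarrow> nat \<Rightarrow> (nat \<Rightarrow> real ^ 'n \<Rightarrow> real) \<Rightarrow> real ^ 'n \<Rightarrow> bool"
where
  "nlp_feasible m g l h \<theta> \<longleftrightarrow> (\<forall>i\<in>{1..m}. g i \<theta> \<le> 0) \<and> (\<forall>j\<in>{1..l}. h j \<theta> = 0)"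

definition nlp_solution ::
  "(real ^ 'n \<Rightarrow> real) \<Rightarrow> nat \<Rightarrow> (nat \<Rightarrow> real ^ 'n \<Rightarrow> real) \<Rightarrow> nat \<Rightarrow> (nat \<Rightarrow> real ^ 'n \<Rightarrow> real) \<Rightarrow>
   real ^ 'n \<Rightarrow> bool"
where
  "nlp_solution f m g l h = is_arg_min f (nlp_feasible m g l h)"

definition kkt ::
  "(real ^ 'n \<Rightarrow> real) \<Rightarrow> nat \<Rightarrow> (nat \<Rightarrow> real ^ 'n \<Rightarrow> real) \<Rightarrow> nat \<Rightarrow> (nat \<Rightarrow> real ^ 'n \<Rightarrow> real) \<Rightarrow>
   real ^ 'n \<Rightarrow> (nat \<Rightarrow> real) \<Rightarrow> (nat \<Rightarrow> real) \<Rightarrow> bool"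
where
  "kkt f m g l h \<theta> u v \<longleftrightarrow>
     grad f \<theta> + (\<Sum>i\<in>{1..m}. u i *\<^sub>R grad (g i) \<theta>) + (\<Sum>j\<in>{1..l}. v j *\<^sub>R grad (h j) \<theta>) = 0 \<and>
     (\<forall>i\<in>{1..m}. g i \<theta> \<le> 0) \<and>
     (\<forall>j\<in>{1..l}. h j \<theta> = 0) \<and>
     (\<forall>i\<in>{1..m}. u i \<ge> 0) \<and>
     (\<Sum>i\<in>{1..m}. u i * g i \<theta>) = 0"

definition qp_feasible ::
  "real \<Rightarrow> nat \<Rightarrow> (nat \<Rightarrow> real ^ 'n \<Rightarrow> real) \<Rightarrow> nat \<Rightarrow> (nat \<Rightarrow> real ^ 'n \<Rightarrow> real) \<Rightarrow>
   real ^ 'n \<Rightarrow> real ^ 'n \<Rightarrow> bool"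
where
  "qp_feasible \<alpha> m g l h \<theta> \<xi> \<longleftrightarrow>
     (\<forall>i\<in>{1..m}. grad (g i) \<theta> \<bullet> \<xi> \<le> - \<alpha> * g i \<theta>) \<and>
     (\<forall>j\<in>{1..l}. grad (h j) \<theta> \<bullet> \<xi> = - \<alpha> * h j \<theta>)"

definition qp_objective :: "(real ^ 'n \<Rightarrow> real) \<Rightarrow> real ^ 'n \<Rightarrow> real ^ 'n \<Rightarrow> real" where
  "qp_objective f \<theta> \<xi> = 1 / 2 * (norm (\<xi> + grad f \<theta>))\<^sup>2"

text \<open>The objective is strictly convex, so the minimiser is unique whenever it exists.\<close>

definition safe_gradient_flow ::
  "real \<Rightarrow> (real ^ 'n \<Rightarrow> real) \<Rightarrow> nat \<Rightarrow> (nat \<Rightarrow> real ^ 'n \<Rightarrow> real) \<Rightarrow> nat \<Rightarrow>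
   (nat \<Rightarrow> real ^ 'n \<Rightarrow> real) \<Rightarrow> real ^ 'n \<Rightarrow> real ^ 'n"
where
  "safe_gradient_flow \<alpha> f m g l h \<theta> = arg_min (qp_objective f \<theta>) (qp_feasible \<alpha> m g l h \<theta>)"

text \<open>
  Full row rank of the Jacobian of \<open>h\<close> says that the span of its rows has as dimension the number
  \<open>l\<close> of rows.
\<close>

definition mfcq_qp ::
  "real \<Rightarrow> (real ^ 'n \<Rightarrow> real) \<Rightarrow> nat \<Rightarrow> (nat \<Rightarrow> real ^ 'n \<Rightarrow> real) \<Rightarrow> nat \<Rightarrow>
   (nat \<Rightarrow> real ^ 'n \<Rightarrow> real) \<Rightarrow> real ^ 'n \<Rightarrow> bool"
where
  "mfcq_qp \<alpha> f m g l h \<theta> \<longleftrightarrow>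
     (\<exists>\<xi>. is_arg_min (qp_objective f \<theta>) (qp_feasible \<alpha> m g l h \<theta>) \<xi> \<and>
        dim (span ((\<lambda>j. grad (h j) \<theta>) ` {1..l})) = l \<and>
        (\<exists>d. (\<forall>j\<in>{1..l}. grad (h j) \<theta> \<bullet> d = 0) \<and>
             (\<forall>i\<in>{i\<in>{1..m}. grad (g i) \<theta> \<bullet> \<xi> + \<alpha> * g i \<theta> = 0}. grad (g i) \<theta> \<bullet> d < 0)))"

definition constraint_sublevel ::
  "nat \<Rightarrow> (nat \<Rightarrow> real ^ 'n \<Rightarrow> real) \<Rightarrow> nat \<Rightarrow> (nat \<Rightarrow> real ^ 'n \<Rightarrow> real) \<Rightarrow>
   (nat \<Rightarrow> real) \<Rightarrow> (nat \<Rightarrow> real) \<Rightarrow> (real ^ 'n) set"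
where
  "constraint_sublevel m g l h gbar hbar =
     {\<theta>. (\<forall>i\<in>{1..m}. g i \<theta> \<le> gbar i) \<and> (\<forall>j\<in>{1..l}. \<bar>h j \<theta>\<bar> \<le> hbar j)}"

definition ode_solution ::
  "('a :: real_normed_vector \<Rightarrow> 'a) \<Rightarrow> real set \<Rightarrow> (real \<Rightarrow> 'a) \<Rightarrow> bool"
where
  "ode_solution F J x \<longleftrightarrow> (\<forall>t\<in>J. (x has_vector_derivative F (x t)) (at t within J))"

text \<open>
  Uniqueness of trajectories is not part of the notion: stability and convergence are required of
  every trajectory. The second and third conjuncts say that trajectories exist from every initial
  point and that none of them escapes in finite time, so that the last two conjuncts are not vacuous
  and apply to all trajectories.
\<close>

definition globally_asymptotically_stable ::
  "('a :: real_normed_vector \<Rightarrow> 'a) \<Rightarrow> 'a \<Rightarrow> bool"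
where
  "globally_asymptotically_stable F e \<longleftrightarrow>
     F e = 0 \<and>
     (\<forall>x0. \<exists>x. ode_solution F {0..} x \<and> x 0 = x0) \<and>
     (\<forall>T>0. \<forall>x. ode_solution F {0..<T} x \<longrightarrow>
        (\<exists>y. ode_solution F {0..} y \<and> (\<forall>t\<in>{0..<T}. y t = x t))) \<and>
     (\<forall>\<epsilon>>0. \<exists>\<delta>>0. \<forall>x. ode_solution F {0..} x \<and> dist (x 0) e < \<delta> \<longrightarrow>
        (\<forall>t\<ge>0. dist (x t) e < \<epsilon>)) \<and>
     (\<forall>x. ode_solution F {0..} x \<longrightarrow> (x \<longlongrightarrow> e) at_top)"

end

theory Submission
  imports Defs "HOL-Complex_Analysis.Great_Picard"
begin

text \<open>
  Write \<open>G\<close> for the flow. MFCQ provides a Slater point of (QP), hence a local error bound: every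
  \<open>\<xi>\<close> has a feasible point within a constant times \<open>(1 + norm \<xi>)\<close> times its constraint violation,
  uniformly for nearby \<open>\<theta>\<close>. Together with the variational inequality
  \<open>(G \<theta> + grad f \<theta>) \<bullet> (\<xi> - G \<theta>) \<ge> 0\<close> this makes \<open>G\<close> continuous and, for \<open>\<xi>\<close> near \<open>0\<close>, gives
  \<open>grad f \<theta> \<bullet> G \<theta> \<le> - (norm (G \<theta>))\<^sup>2 + K * violation \<theta> 0\<close> locally uniformly. Peano's
  theorem yields trajectories, and compactness of the constraint
  sublevel sets, which are invariant because the violation decays like \<open>exp (- \<alpha> * t)\<close>, makes them
  global. Thus \<open>f (x t)\<close> plus a multiple of \<open>exp (- \<alpha> * t)\<close> is a Lyapunov function that can
  only stop decreasing near zeros of \<open>G\<close>, and these are the KKT points by Farkas' lemma. For stability,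
  \<open>max 0 (f \<theta> - f \<theta>star) + violation \<theta> 0\<close> is bounded away from \<open>0\<close> on small spheres around \<open>\<theta>star\<close>
  but stays small along trajectories that start close to \<open>\<theta>star\<close>.
\<close>

subsection \<open>Trajectories of continuous vector fields\<close>

text \<open>The estimate behind continuity bounds the square of
  \<open>norm (G \<theta> - G \<theta>0)\<close> by first-order changes of the data, so it gives no
  Lipschitz constant, and uniqueness of trajectories is not at hand. Hence existence comes from
  compactness, continuation from gluing, and each assertion about trajectories is an a priori
  estimate valid for all of them. The constant of the dissipation inequality is only local and
  becomes uniform on a compact set, so a trajectory must first be confined: by an invariant sublevel
  set for convergence, by a closed ball up to the first exit time for stability. The violation term
  is there because \<open>\<xi> = 0\<close> is admissible in (QP) only at feasible points; elsewhere
  restoring feasibility may raise \<open>f\<close>. Uniqueness of the KKT point makes \<theta>star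
  the only zero of \<open>G\<close> and drives convergence; uniqueness of the minimiser makes the
  penalty function positive away from \<theta>star, where \<open>f\<close> itself may lie below
  \<open>f \<theta>star\<close>.\<close>

lemma has_vector_derivative_linear_bound:
  fixes x :: "real \<Rightarrow> 'a::real_normed_vector"
  assumes "\<And>r. r \<in> {s..t} \<Longrightarrow> (x has_vector_derivative x' r) (at r within {s..t})"
    and "\<And>r. r \<in> {s..t} \<Longrightarrow> norm (x' r - v) \<le> \<epsilon>"
    and "s \<le> t"
  shows "norm (x t - x s - (t - s) *\<^sub>R v) \<le> (t - s) * \<epsilon>"
proof -
  \<comment> \<open>The mean value inequality for \<open>x r - r *\<^sub>R v\<close>. With
    \<open>v = 0\<close> the lemma gives Lipschitz bounds, with \<open>v\<close> a value of the
    field it gives differentiability at the end of an interval.\<close>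
  have "norm ((x t - t *\<^sub>R v) - (x s - s *\<^sub>R v)) \<le> \<epsilon> * norm (t - s)"
  proof (rule differentiable_bound[of "{s..t}" _ "\<lambda>r d. d *\<^sub>R (x' r - v)"])
    fix r assume r: "r \<in> {s..t}"
    have "((\<lambda>r. x r - r *\<^sub>R v) has_vector_derivative x' r - v) (at r within {s..t})"
      using assms(1)[OF r] by (auto intro!: derivative_eq_intros)
    then show "((\<lambda>r. x r - r *\<^sub>R v) has_derivative (\<lambda>d. d *\<^sub>R (x' r - v))) (at r within {s..t})"
      by (simp add: has_vector_derivative_def)
    have "onorm (\<lambda>d::real. d *\<^sub>R (x' r - v)) \<le> norm (x' r - v)"
      by (rule onorm_le) (simp add: mult.commute)
    then show "onorm (\<lambda>d::real. d *\<^sub>R (x' r - v)) \<le> \<epsilon>"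
      using assms(2)[OF r] by linarith
  qed (use assms(3) in auto)
  moreover have "(x t - t *\<^sub>R v) - (x s - s *\<^sub>R v) = x t - x s - (t - s) *\<^sub>R v"
    by (simp add: algebra_simps)
  ultimately show ?thesis
    using assms(3) by (simp add: mult.commute)
qed

lemma nonincreasing_if_derivative_nonpos:
  fixes \<psi> :: "real \<Rightarrow> real"
  assumes "a \<le> b"
    and "\<And>r. r \<in> {a..b} \<Longrightarrow> (\<psi> has_real_derivative \<psi>' r) (at r within {a..b})"
    and "\<And>r. r \<in> {a..b} \<Longrightarrow> \<psi>' r \<le> 0"
  shows "\<psi> b \<le> \<psi> a"
proof (cases "a = b")
  case False
  then have "a < b" using assms(1) by simp
  then obtain r where r: "r \<in> {a<..<b}" "\<psi> b - \<psi> a = \<psi>' r * (b - a)"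
    using mvt_simple[of a b \<psi> "\<lambda>r. (*) (\<psi>' r)"] assms(2)
    by (auto simp: has_field_derivative_def)
  have "\<psi>' r * (b - a) \<le> 0"
    using r(1) assms(3)[of r] \<open>a < b\<close> by (intro mult_nonpos_nonneg) auto
  with r show ?thesis by linarith
qed simp

text \<open>The integrating factor \<open>exp (\<alpha> * r)\<close> turns the differential
  inequality into monotonicity. No sign of \<open>\<phi>\<close> enters, so the lemma also applies
  to \<open>- h j\<close>.\<close>

lemma exponential_decay:
  fixes \<phi> :: "real \<Rightarrow> real"
  assumes "0 \<le> b"
    and "\<And>r. r \<in> {0..b} \<Longrightarrow> (\<phi> has_real_derivative \<phi>' r) (at r within {0..b})"
    and "\<And>r. r \<in> {0..b} \<Longrightarrow> \<phi>' r \<le> - \<alpha> * \<phi> r"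
  shows "\<phi> b \<le> exp (- \<alpha> * b) * \<phi> 0"
proof -
  have "exp (\<alpha> * b) * \<phi> b \<le> exp (\<alpha> * 0) * \<phi> 0"
  proof (rule nonincreasing_if_derivative_nonpos
      [where \<psi> = "\<lambda>r. exp (\<alpha> * r) * \<phi> r"
         and \<psi>' = "\<lambda>r. exp (\<alpha> * r) * (\<phi>' r + \<alpha> * \<phi> r)"])
    fix r assume r: "r \<in> {0..b}"
    show "((\<lambda>r. exp (\<alpha> * r) * \<phi> r) has_real_derivative exp (\<alpha> * r) * (\<phi>' r + \<alpha> * \<phi> r))
            (at r within {0..b})"
      by (rule derivative_eq_intros assms(2)[OF r] refl | simp add: algebra_simps)+
    show "exp (\<alpha> * r) * (\<phi>' r + \<alpha> * \<phi> r) \<le> 0"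
      using assms(3)[OF r] by (intro mult_nonneg_nonpos) auto
  qed (rule assms(1))
  then have "exp (- \<alpha> * b) * (exp (\<alpha> * b) * \<phi> b) \<le> exp (- \<alpha> * b) * \<phi> 0"
    by (intro mult_left_mono) auto
  then show ?thesis
    by (simp add: mult.assoc[symmetric] exp_add[symmetric])
qed

text \<open>Lets an estimate that is known only inside a region be used along a trajectory until it
  first reaches the boundary. The least time in the compact level set does it: a larger value before
  it would, by the intermediate value theorem, produce an earlier crossing.\<close>

lemma first_hitting_time:
  fixes \<phi> :: "real \<Rightarrow> real"
  assumes "continuous_on {0..t} \<phi>" "0 \<le> t" "\<phi> 0 < e" "e \<le> \<phi> t"
  obtains s where "s \<in> {0..t}" "\<phi> s = e" "\<And>r. r \<in> {0..s} \<Longrightarrow> \<phi> r \<le> e"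
proof -
  define S where "S = {r \<in> {0..t}. \<phi> r = e}"
  have "closed S"
    unfolding S_def by (intro continuous_closed_preimage_constant assms) auto
  then have "compact ({0..t} \<inter> S)"
    by (intro compact_Int_closed compact_Icc)
  moreover have "{0..t} \<inter> S = S"
    by (auto simp: S_def)
  ultimately have "compact S"
    by simp
  moreover have "S \<noteq> {}"
    using IVT'[of \<phi> 0 e t] assms unfolding S_def by force
  ultimately obtain s where s: "s \<in> S" "\<And>r. r \<in> S \<Longrightarrow> s \<le> r"
    using compact_attains_inf[of S] by metis
  have "\<phi> r \<le> e" if r: "r \<in> {0..s}" for r
  proof (rule ccontr)
    assume "\<not> \<phi> r \<le> e"
    then have gt: "e < \<phi> r" by simp
    have "continuous_on {0..r} \<phi>"
      using assms(1) that s(1) by (auto simp: S_def elim!: continuous_on_subset)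
    then obtain q where "0 \<le> q" "q \<le> r" "\<phi> q = e"
      using IVT'[of \<phi> 0 e r] assms(3) gt r by auto
    then have "s \<le> q" using s that by (auto simp: S_def)
    with \<open>q \<le> r\<close> r have "q = r" by auto
    then show False using gt \<open>\<phi> q = e\<close> by simp
  qed
  then show ?thesis using that s(1) by (auto simp: S_def)
qed

lemma ode_solution_subset:
  "ode_solution F J x \<Longrightarrow> I \<subseteq> J \<Longrightarrow> ode_solution F I x"
  unfolding ode_solution_def by (meson has_vector_derivative_within_subset subsetD)

lemma ode_solution_continuous_on:
  "ode_solution F J x \<Longrightarrow> continuous_on J x"
  unfolding ode_solution_def
  using continuous_on_eq_continuous_within has_vector_derivative_continuous by blast

section \<open>Euler's scheme and Peano's theorem\<close>

definition euler :: "('a::real_vector \<Rightarrow> 'a) \<Rightarrow> 'a \<Rightarrow> real \<Rightarrow> nat \<Rightarrow> 'a" where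
  "euler F x0 \<eta> n = ((\<lambda>z. z + \<eta> *\<^sub>R F z) ^^ n) x0"

lemma euler_0 [simp]: "euler F x0 \<eta> 0 = x0"
  and euler_Suc: "euler F x0 \<eta> (Suc n) = euler F x0 \<eta> n + \<eta> *\<^sub>R F (euler F x0 \<eta> n)"
  by (simp_all add: euler_def)

text \<open>Discrete counterpart of \<open>has_vector_derivative_linear_bound\<close>. This form of
  the equation contains no derivative and therefore survives the limit of the step size to
  0.\<close>

lemma euler_linear_bound:
  fixes F :: "'a::real_normed_vector \<Rightarrow> 'a"
  assumes "m \<le> n" "0 \<le> \<eta>"
    and "\<And>j. m \<le> j \<Longrightarrow> j < n \<Longrightarrow> norm (F (euler F x0 \<eta> j) - v) \<le> \<epsilon>"
  shows "norm (euler F x0 \<eta> n - euler F x0 \<eta> m - ((real n - real m) * \<eta>) *\<^sub>R v)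
           \<le> (real n - real m) * \<eta> * \<epsilon>"
  using assms(1,3)
proof (induction rule: dec_induct)
  case (step n)
  let ?y = "euler F x0 \<eta>"
  have "?y (Suc n) - ?y m - ((real (Suc n) - real m) * \<eta>) *\<^sub>R v
      = (?y n - ?y m - ((real n - real m) * \<eta>) *\<^sub>R v) + \<eta> *\<^sub>R (F (?y n) - v)"
    by (simp add: euler_Suc algebra_simps)
  moreover have "(real (Suc n) - real m) * \<eta> * \<epsilon> = (real n - real m) * \<eta> * \<epsilon> + \<eta> * \<epsilon>"
    by (simp add: algebra_simps)
  moreover have "norm (?y n - ?y m - ((real n - real m) * \<eta>) *\<^sub>R v) \<le> (real n - real m) * \<eta> * \<epsilon>"
    using step by simp
  moreover have "norm (\<eta> *\<^sub>R (F (?y n) - v)) \<le> \<eta> * \<epsilon>"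
    using step.prems[of n] step.hyps assms(2) by (simp add: mult_left_mono)
  ultimately show ?case
    by (metis add_mono norm_triangle_le)
qed simp

text \<open>Peano's theorem: a subsequence of the Euler polygons converges at all rational times, hence by
  equicontinuity at all times.\<close>

theorem peano_global:
  fixes F :: "'a::euclidean_space \<Rightarrow> 'a"
  assumes cont: "continuous_on UNIV F" and bound: "\<And>z. norm (F z) \<le> B"
  shows "\<exists>x. ode_solution F {0..} x \<and> x 0 = x0"
proof -
  have B: "0 \<le> B" using bound[of 0] norm_ge_zero order_trans by blast
  define \<eta> where "\<eta> k = 1 / real (Suc k)" for k
  have \<eta>: "\<eta> k > 0" for k by (simp add: \<eta>_def)
  have \<eta>0: "\<eta> \<longlonglongrightarrow> 0"
    unfolding \<eta>_def by (rule LIMSEQ_Suc[OF lim_1_over_n])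
  \<comment> \<open>Step functions through the Euler nodes. Rounding \<open>t\<close> down to the
    grid costs at most \<open>\<eta> k\<close> in time, which is why the bounds below carry terms
    with \<open>\<eta> k\<close> that vanish in the limit.\<close>
  define X where "X k t = euler F x0 (\<eta> k) (nat \<lfloor>t / \<eta> k\<rfloor>)" for k t
  have floor_bounds: "real (nat \<lfloor>t / \<eta> k\<rfloor>) * \<eta> k \<le> t" "t - \<eta> k < real (nat \<lfloor>t / \<eta> k\<rfloor>) * \<eta> k"
    if "0 \<le> t" for t k
  proof -
    have "0 \<le> t / \<eta> k" using that \<eta>[of k] by simp
    then have "real (nat \<lfloor>t / \<eta> k\<rfloor>) \<le> t / \<eta> k" "t / \<eta> k < real (nat \<lfloor>t / \<eta> k\<rfloor>) + 1"
      by linarith+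
    then show "real (nat \<lfloor>t / \<eta> k\<rfloor>) * \<eta> k \<le> t" "t - \<eta> k < real (nat \<lfloor>t / \<eta> k\<rfloor>) * \<eta> k"
      using \<eta>[of k] by (simp_all add: field_simps)
  qed
  \<comment> \<open>The range of \<open>j\<close> starts at \<open>s - \<eta> k\<close> because the
    node used for \<open>s\<close> may lie up to one grid step before \<open>s\<close>.\<close>
  have X_bound: "norm (X k t - X k s - (t - s) *\<^sub>R v) \<le> (t - s + \<eta> k) * \<epsilon> + \<eta> k * norm v"
    if st: "0 \<le> s" "s \<le> t" and "0 \<le> \<epsilon>"
      and close: "\<And>j. s - \<eta> k < real j * \<eta> k \<Longrightarrow> real j * \<eta> k \<le> t \<Longrightarrow>
                     norm (F (euler F x0 (\<eta> k) j) - v) \<le> \<epsilon>" for k s t v \<epsilon>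
  proof -
    let ?m = "nat \<lfloor>s / \<eta> k\<rfloor>" and ?n = "nat \<lfloor>t / \<eta> k\<rfloor>"
    have t: "0 \<le> t" using st by simp
    have mn: "?m \<le> ?n"
      using st \<eta>[of k] by (intro nat_mono floor_mono divide_right_mono) auto
    have "norm (X k t - X k s - ((real ?n - real ?m) * \<eta> k) *\<^sub>R v) \<le> (real ?n - real ?m) * \<eta> k * \<epsilon>"
      unfolding X_def
    proof (rule euler_linear_bound[OF mn])
      fix j assume j: "?m \<le> j" "j < ?n"
      have "real ?m * \<eta> k \<le> real j * \<eta> k" "real j * \<eta> k \<le> real ?n * \<eta> k"
        using j \<eta>[of k] by (auto intro!: mult_right_mono)
      then show "norm (F (euler F x0 (\<eta> k) j) - v) \<le> \<epsilon>"
        using floor_bounds[OF st(1), of k] floor_bounds[OF t, of k] by (intro close) linarith+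
    qed (use \<eta>[of k] in auto)
    moreover have d: "\<bar>(real ?n - real ?m) * \<eta> k - (t - s)\<bar> \<le> \<eta> k"
      using floor_bounds[OF st(1), of k] floor_bounds[OF t, of k]
      by (simp add: left_diff_distrib)
    moreover have "norm (((real ?n - real ?m) * \<eta> k - (t - s)) *\<^sub>R v) \<le> \<eta> k * norm v"
      using d by (simp add: mult_right_mono)
    moreover have "(real ?n - real ?m) * \<eta> k * \<epsilon> \<le> (t - s + \<eta> k) * \<epsilon>"
      using d \<open>0 \<le> \<epsilon>\<close> by (intro mult_right_mono) auto
    moreover have "X k t - X k s - (t - s) *\<^sub>R v
        = (X k t - X k s - ((real ?n - real ?m) * \<eta> k) *\<^sub>R v)
          + ((real ?n - real ?m) * \<eta> k - (t - s)) *\<^sub>R v"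
      by (simp add: algebra_simps)
    ultimately show ?thesis
      by (smt (verit) norm_triangle_ineq)
  qed
  have X_lip: "norm (X k t - X k s) \<le> B * (\<bar>t - s\<bar> + \<eta> k)" if "0 \<le> s" "0 \<le> t" for k s t
  proof (cases "s \<le> t")
    case True
    with X_bound[of s t B k 0] that B bound show ?thesis
      by (simp add: mult.commute)
  next
    case False
    with X_bound[of t s B k 0] that B bound show ?thesis
      by (simp add: mult.commute norm_minus_commute)
  qed
  have X_0: "X k 0 = x0" for k
    by (simp add: X_def)
  have X_0_lip: "norm (X k t - x0) \<le> B * t" if "0 \<le> t" for k t
  proof -
    let ?n = "nat \<lfloor>t / \<eta> k\<rfloor>"
    have "norm (X k t - x0) \<le> real ?n * \<eta> k * B"
      using euler_linear_bound[of 0 ?n "\<eta> k" F x0 0 B] bound \<eta>[of k] by (simp add: X_def less_imp_le)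
    also have "\<dots> \<le> t * B"
      using floor_bounds[OF that, of k] B by (intro mult_right_mono) auto
    finally show ?thesis by (simp add: mult.commute)
  qed
  \<comment> \<open>The subsequence theorem asks for one bound at all times. Division by
    \<open>1 + B * t\<close> brings the linear growth below 1 and is undone in
    \<open>rat_conv\<close>.\<close>
  obtain r :: "nat \<Rightarrow> nat" where r: "strict_mono r"
    and r_conv: "\<And>t. t \<in> {0..} \<inter> \<rat> \<Longrightarrow>
                   \<exists>z. (\<lambda>n. (1 / (1 + B * t)) *\<^sub>R (X (r n) t - x0)) \<longlonglongrightarrow> z"
  proof (rule function_convergent_subsequence
      [where S = "{0..} \<inter> \<rat>" and M = 1 and f = "\<lambda>n t. (1 / (1 + B * t)) *\<^sub>R (X n t - x0)"])
    show "countable ({0..} \<inter> (\<rat> :: real set))"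
      using countable_rat countable_Int2 by blast
    fix n and t :: real assume t: "t \<in> {0..} \<inter> \<rat>"
    then have "0 < 1 + B * t" using B by (simp add: add_pos_nonneg)
    then show "norm ((1 / (1 + B * t)) *\<^sub>R (X n t - x0)) \<le> 1"
      using X_0_lip[of t n] t by (simp only: norm_scaleR) (simp add: pos_divide_le_eq)
  qed blast
  have \<eta>r: "(\<lambda>n. \<eta> (r n)) \<longlonglongrightarrow> 0"
    using LIMSEQ_subseq_LIMSEQ[OF \<eta>0 r] by (simp add: comp_def)
  have rat_conv: "convergent (\<lambda>n. X (r n) q)" if q: "q \<in> {0..} \<inter> \<rat>" for q
  proof -
    have pos: "1 + B * q \<noteq> 0" using B q by (smt (verit) IntD1 atLeast_iff mult_nonneg_nonneg)
    obtain z where "(\<lambda>n. (1 / (1 + B * q)) *\<^sub>R (X (r n) q - x0)) \<longlonglongrightarrow> z"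
      using r_conv[OF q] by blast
    then have "(\<lambda>n. (1 + B * q) *\<^sub>R ((1 / (1 + B * q)) *\<^sub>R (X (r n) q - x0)) + x0)
        \<longlonglongrightarrow> (1 + B * q) *\<^sub>R z + x0"
      by (intro tendsto_intros)
    then have "(\<lambda>n. X (r n) q) \<longlonglongrightarrow> (1 + B * q) *\<^sub>R z + x0"
      using pos by simp
    then show ?thesis by (auto simp: convergent_def)
  qed
  have conv: "convergent (\<lambda>n. X (r n) t)" if t: "0 \<le> t" for t
  proof -
    have "Cauchy (\<lambda>n. X (r n) t)"
    proof (rule metric_CauchyI)
      fix e :: real assume e: "0 < e"
      \<comment> \<open>Replacing \<open>t\<close> by such a \<open>q\<close> moves
        \<open>X (r i)\<close> by less than \<open>e / 3\<close> once
        \<open>B * \<eta> (r i) < e / 6\<close>; dividing by \<open>B + 1\<close> also covers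
        \<open>B = 0\<close>.\<close>
      obtain q where q: "q \<in> \<rat>" "t < q" "q < t + e / (6 * (B + 1))"
        using Rats_dense_in_real[of t "t + e / (6 * (B + 1))"] e B by auto
      have Bq: "B * (q - t) \<le> e / 6"
      proof -
        have "B * (q - t) \<le> (B + 1) * (e / (6 * (B + 1)))"
          using q B by (intro mult_mono) auto
        also have "\<dots> = e / 6" using B by (simp add: field_simps)
        finally show ?thesis .
      qed
      have "Cauchy (\<lambda>n. X (r n) q)"
        using rat_conv[of q] q t convergent_Cauchy by auto
      then obtain N1 where N1: "\<And>i j. i \<ge> N1 \<Longrightarrow> j \<ge> N1 \<Longrightarrow> dist (X (r i) q) (X (r j) q) < e / 6"
        using metric_CauchyD[of _ "e / 6"] e by (metis zero_less_divide_iff zero_less_numeral)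
      have "(\<lambda>n. B * \<eta> (r n)) \<longlonglongrightarrow> 0"
        using tendsto_mult_right_zero[OF \<eta>r] by blast
      then have "eventually (\<lambda>n. B * \<eta> (r n) < e / 6) sequentially"
        using e order_tendstoD(2) by (metis zero_less_divide_iff zero_less_numeral)
      then obtain N2 where N2: "\<And>i. i \<ge> N2 \<Longrightarrow> B * \<eta> (r i) < e / 6"
        by (auto simp: eventually_sequentially)
      have near: "dist (X (r i) t) (X (r i) q) < e / 3" if "i \<ge> N2" for i
        using X_lip[of q t "r i"] q t N2[OF that] Bq by (simp add: dist_norm distrib_left)
      have "dist (X (r i) t) (X (r j) t) < e" if "i \<ge> max N1 N2" "j \<ge> max N1 N2" for i j
        using near[of i] near[of j] N1[of i j] that e
          dist_triangle[of "X (r i) t" "X (r j) t" "X (r i) q"]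
          dist_triangle[of "X (r i) q" "X (r j) t" "X (r j) q"]
        by (simp add: dist_commute)
      then show "\<exists>M. \<forall>i\<ge>M. \<forall>j\<ge>M. dist (X (r i) t) (X (r j) t) < e" by blast
    qed
    then show ?thesis by (rule Cauchy_convergent)
  qed
  define x where "x t = lim (\<lambda>n. X (r n) t)" for t
  have X_lim: "(\<lambda>n. X (r n) t) \<longlonglongrightarrow> x t" if "0 \<le> t" for t
    using conv[OF that] by (simp add: x_def convergent_LIMSEQ_iff)
  have "\<exists>d>0. \<forall>s t. 0 \<le> s \<longrightarrow> s \<le> t \<longrightarrow> \<tau> - d \<le> s \<longrightarrow> t \<le> \<tau> + d \<longrightarrow>
          norm (x t - x s - (t - s) *\<^sub>R F (x \<tau>)) \<le> (t - s) * \<epsilon>"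
    if \<tau>: "0 \<le> \<tau>" and \<epsilon>: "0 < \<epsilon>" for \<tau> \<epsilon>
  proof -
    obtain \<delta> where \<delta>: "0 < \<delta>" "\<And>z. dist z (x \<tau>) < \<delta> \<Longrightarrow> dist (F z) (F (x \<tau>)) < \<epsilon>"
      using cont \<epsilon> unfolding continuous_on_iff by (metis UNIV_I)
    \<comment> \<open>Budget for the nodes at times within \<open>d\<close> of \<tau>, up to one
      grid step: \<open>\<delta> / 4\<close> for convergence at \<tau>, \<open>\<delta> / 4\<close>
      for the drift during time \<open>d\<close>, \<open>\<delta> / 4\<close> for the grid error.
      All these nodes then lie where \<open>F\<close> is \<epsilon>-close to
      \<open>F (x \<tau>)\<close>, and the discrete bound passes to the limit.\<close>
    define d where "d = \<delta> / (4 * (B + 1))"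
    have d: "0 < d" "B * d \<le> \<delta> / 4"
      using \<delta>(1) B by (simp_all add: d_def field_simps)
    have "norm (x t - x s - (t - s) *\<^sub>R F (x \<tau>)) \<le> (t - s) * \<epsilon>"
      if st: "0 \<le> s" "s \<le> t" "\<tau> - d \<le> s" "t \<le> \<tau> + d" for s t
    proof (rule tendsto_le[OF sequentially_bot])
      show "(\<lambda>n. norm (X (r n) t - X (r n) s - (t - s) *\<^sub>R F (x \<tau>)))
          \<longlonglongrightarrow> norm (x t - x s - (t - s) *\<^sub>R F (x \<tau>))"
        using st by (intro tendsto_intros X_lim) auto
      have "(\<lambda>n. (t - s + \<eta> (r n)) * \<epsilon> + \<eta> (r n) * norm (F (x \<tau>)))
          \<longlonglongrightarrow> (t - s + 0) * \<epsilon> + 0 * norm (F (x \<tau>))"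
        by (intro tendsto_intros \<eta>r)
      then show "(\<lambda>n. (t - s + \<eta> (r n)) * \<epsilon> + \<eta> (r n) * norm (F (x \<tau>))) \<longlonglongrightarrow> (t - s) * \<epsilon>"
        by simp
      have "eventually (\<lambda>n. dist (X (r n) \<tau>) (x \<tau>) < \<delta> / 4) sequentially"
        using X_lim[OF \<tau>] \<delta>(1) by (intro tendstoD) auto
      moreover have "(\<lambda>n. B * (2 * \<eta> (r n))) \<longlonglongrightarrow> B * (2 * 0)"
        by (intro tendsto_intros \<eta>r)
      then have "eventually (\<lambda>n. B * (2 * \<eta> (r n)) < \<delta> / 4) sequentially"
        by (rule order_tendstoD(2)) (use \<delta>(1) in simp)
      ultimately show "eventually (\<lambda>n. norm (X (r n) t - X (r n) s - (t - s) *\<^sub>R F (x \<tau>))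
          \<le> (t - s + \<eta> (r n)) * \<epsilon> + \<eta> (r n) * norm (F (x \<tau>))) sequentially"
      proof eventually_elim
        case (elim n)
        show ?case
        proof (rule X_bound)
          fix j assume j: "s - \<eta> (r n) < real j * \<eta> (r n)" "real j * \<eta> (r n) \<le> t"
          let ?y = "euler F x0 (\<eta> (r n)) j"
          have y: "X (r n) (real j * \<eta> (r n)) = ?y"
            using \<eta>[of "r n"] by (simp add: X_def)
          have "norm (?y - X (r n) \<tau>) \<le> B * (\<bar>real j * \<eta> (r n) - \<tau>\<bar> + \<eta> (r n))"
            using X_lip[of \<tau> "real j * \<eta> (r n)" "r n"] \<tau> \<eta>[of "r n"] y by (simp add: less_imp_le)
          also have "\<dots> \<le> B * (d + 2 * \<eta> (r n))"
            using j st \<tau> B \<eta>[of "r n"] by (intro mult_left_mono) (auto simp: abs_le_iff)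
          also have "\<dots> < \<delta> / 2"
            using d(2) elim(2) by (simp add: distrib_left)
          finally have "dist ?y (x \<tau>) < \<delta>"
            using elim(1) \<delta>(1) dist_triangle[of ?y "x \<tau>" "X (r n) \<tau>"] by (simp add: dist_norm)
          from \<delta>(2)[OF this] show "norm (F ?y - F (x \<tau>)) \<le> \<epsilon>"
            by (simp add: dist_norm)
        qed (use st \<epsilon> in auto)
      qed
    qed
    with d(1) show ?thesis by blast
  qed
  note local_bound = this
  have "(x has_vector_derivative F (x \<tau>)) (at \<tau> within {0..})" if \<tau>: "0 \<le> \<tau>" for \<tau>
    unfolding has_vector_derivative_def has_derivative_within_alt
  proof (intro conjI allI impI)
    fix \<epsilon> :: real assume "0 < \<epsilon>"
    then obtain d where d: "0 < d" "\<And>s t. 0 \<le> s \<Longrightarrow> s \<le> t \<Longrightarrow> \<tau> - d \<le> s \<Longrightarrow> t \<le> \<tau> + d \<Longrightarrow>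
          norm (x t - x s - (t - s) *\<^sub>R F (x \<tau>)) \<le> (t - s) * \<epsilon>"
      using local_bound[OF \<tau>] by metis
    have "norm (x t - x \<tau> - (t - \<tau>) *\<^sub>R F (x \<tau>)) \<le> \<epsilon> * norm (t - \<tau>)"
      if "0 \<le> t" "norm (t - \<tau>) < d" for t
    proof (cases "\<tau> \<le> t")
      case True
      then show ?thesis using d(1) d(2)[of \<tau> t] that \<tau> by (simp add: mult.commute)
    next
      case False
      have eq: "norm (x t - x \<tau> - (t - \<tau>) *\<^sub>R F (x \<tau>)) = norm (x \<tau> - x t - (\<tau> - t) *\<^sub>R F (x \<tau>))"
        by (subst norm_minus_cancel[symmetric]) (simp add: algebra_simps)
      show ?thesis
        unfolding eq using False d(1) d(2)[of t \<tau>] that by (simp add: mult.commute)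
    qed
    with d(1) show "\<exists>d>0. \<forall>t\<in>{0..}. norm (t - \<tau>) < d \<longrightarrow>
        norm (x t - x \<tau> - (t - \<tau>) *\<^sub>R F (x \<tau>)) \<le> \<epsilon> * norm (t - \<tau>)"
      by auto
  qed (rule bounded_linear_scaleR_left)
  moreover have "x 0 = x0"
    by (simp add: x_def X_0)
  ultimately show ?thesis
    unfolding ode_solution_def by auto
qed

text \<open>Bounded speed makes \<open>x\<close> Lipschitz, hence uniformly continuous, so it has a
  limit \<open>z\<close> at \<open>T\<close>. Continuity of \<open>F\<close> at \<open>z\<close>
  supplies the derivative there.\<close>

lemma ode_solution_extend_closed:
  fixes F :: "'a::euclidean_space \<Rightarrow> 'a"
  assumes cont: "continuous_on UNIV F" and x: "ode_solution F {0..<T} x" and T: "0 < T"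
    and bound: "\<And>t. t \<in> {0..<T} \<Longrightarrow> norm (F (x t)) \<le> B"
  obtains z where "ode_solution F {0..T} (\<lambda>t. if t < T then x t else z)"
proof -
  have B: "0 \<le> B" using order_trans[OF norm_ge_zero bound[of 0]] T by auto
  have der: "(x has_vector_derivative F (x r)) (at r within {s..t})"
    if "0 \<le> s" "t < T" "r \<in> {s..t}" for r s t
    using ode_solution_subset[OF x, of "{s..t}"] that by (simp add: ode_solution_def subset_iff)
  have lip_le: "norm (x t - x s) \<le> (t - s) * B" if "0 \<le> s" "s \<le> t" "t < T" for s t
    using has_vector_derivative_linear_bound[of s t x "\<lambda>r. F (x r)" 0 B] der that bound by auto
  have "B-lipschitz_on {0..<T} x"
  proof (rule lipschitz_onI)
    fix s t assume "s \<in> {0..<T}" "t \<in> {0..<T}"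
    then show "dist (x s) (x t) \<le> B * dist s t"
      using lip_le[of s t] lip_le[of t s]
      by (cases "s \<le> t") (auto simp: dist_norm norm_minus_commute mult.commute)
  qed (rule B)
  then have "uniformly_continuous_on {0..<T} x"
    by (rule lipschitz_on_uniformly_continuous)
  then obtain z where z: "(x \<longlongrightarrow> z) (at T within {0..<T})"
    by (rule uniformly_continuous_on_extension_at_closure[where x = T]) (use T in auto)
  let ?y = "\<lambda>t. if t < T then x t else z"
  have "(?y has_vector_derivative F (?y \<tau>)) (at \<tau> within {0..T})" if \<tau>: "\<tau> \<in> {0..T}" for \<tau>
  proof (cases "\<tau> < T")
    case True
    have "(x has_vector_derivative F (x \<tau>)) (at \<tau> within {0..<T})"
      using x \<tau> True by (auto simp: ode_solution_def)
    moreover have "at \<tau> within {0..<T} = at \<tau> within {0..T}"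
      using True by (intro at_within_nhd[where S = "{..<T}"]) auto
    ultimately have "(x has_vector_derivative F (x \<tau>)) (at \<tau> within {0..T})"
      by simp
    then show ?thesis
      unfolding has_vector_derivative_def using True \<tau>
      by (auto elim!: has_derivative_transform_within[where d = "T - \<tau>"] simp: dist_real_def)
  next
    case False
    then have [simp]: "\<tau> = T" using \<tau> by simp
    have "(?y has_vector_derivative F z) (at T within {0..T})"
      unfolding has_vector_derivative_def has_derivative_within_alt
    proof (intro conjI allI impI)
      fix \<epsilon> :: real assume \<epsilon>: "0 < \<epsilon>"
      have "((\<lambda>t. F (x t)) \<longlongrightarrow> F z) (at T within {0..<T})"
        using cont z by (auto intro: continuous_on_tendsto_compose)
      then have "eventually (\<lambda>t. dist (F (x t)) (F z) < \<epsilon>) (at T within {0..<T})"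
        using \<epsilon> by (rule tendstoD)
      then obtain d where d: "0 < d"
        "\<forall>t\<in>{0..<T}. t \<noteq> T \<and> dist t T < d \<longrightarrow> dist (F (x t)) (F z) < \<epsilon>"
        unfolding eventually_at by blast
      \<comment> \<open>The linear bound on \<open>{s..t}\<close> with slope \<open>F z\<close> is
        passed to the limit as \<open>t\<close> tends to \<open>T\<close> for fixed
        \<open>s\<close>; the result is the difference quotient estimate for the left derivative at
        \<open>T\<close>.\<close>
      have "norm (z - x s - (T - s) *\<^sub>R F z) \<le> (T - s) * \<epsilon>" if s: "s \<in> {0..<T}" "T - s < d" for s
      proof (rule tendsto_le)
        show "at T within {0..<T} \<noteq> bot"
          using T by (simp add: trivial_limit_within islimpt_Ico)
        show "((\<lambda>t. norm (x t - x s - (t - s) *\<^sub>R F z)) \<longlongrightarrow> norm (z - x s - (T - s) *\<^sub>R F z))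
                (at T within {0..<T})"
          by (intro tendsto_intros z)
        show "((\<lambda>t. (t - s) * \<epsilon>) \<longlongrightarrow> (T - s) * \<epsilon>) (at T within {0..<T})"
          by (intro tendsto_intros)
        have "norm (x t - x s - (t - s) *\<^sub>R F z) \<le> (t - s) * \<epsilon>" if t: "t \<in> {0..<T}" "s < t" for t
        proof (rule has_vector_derivative_linear_bound[where x' = "\<lambda>r. F (x r)"])
          fix r assume r: "r \<in> {s..t}"
          show "(x has_vector_derivative F (x r)) (at r within {s..t})"
            using der s t r by auto
          show "norm (F (x r) - F z) \<le> \<epsilon>"
            using bspec[OF d(2), of r] s t r by (simp add: dist_norm)
        qed (use t in auto)
        moreover have "eventually (\<lambda>t. t \<in> {0..<T}) (at T within {0..<T})"
          by (simp add: eventually_at_filter)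
        moreover have "eventually (\<lambda>t. s < t) (at T within {0..<T})"
          using s by (auto intro: order_tendstoD(1) tendsto_ident_at)
        ultimately show "eventually (\<lambda>t. norm (x t - x s - (t - s) *\<^sub>R F z) \<le> (t - s) * \<epsilon>)
            (at T within {0..<T})"
          by (auto elim: eventually_elim2)
      qed
      then have "norm (?y s - ?y T - (s - T) *\<^sub>R F z) \<le> \<epsilon> * norm (s - T)"
        if "s \<in> {0..T}" "norm (s - T) < d" for s
      proof (cases "s < T")
        case True
        have eq: "norm (x s - z - (s - T) *\<^sub>R F z) = norm (z - x s - (T - s) *\<^sub>R F z)"
          by (subst norm_minus_cancel[symmetric]) (simp add: algebra_simps)
        show ?thesis
          using True that eq \<open>\<And>s. _ \<Longrightarrow> _ \<Longrightarrow> norm (z - x s - (T - s) *\<^sub>R F z) \<le> (T - s) * \<epsilon>\<close>[of s]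
          by (simp add: mult.commute)
      qed (use that in auto)
      with d(1) show "\<exists>d>0. \<forall>s\<in>{0..T}. norm (s - T) < d \<longrightarrow>
          norm (?y s - ?y T - (s - T) *\<^sub>R F z) \<le> \<epsilon> * norm (s - T)"
        by blast
    qed (rule bounded_linear_scaleR_left)
    then show ?thesis by simp
  qed
  then show ?thesis
    using that unfolding ode_solution_def by blast
qed

text \<open>The field is autonomous, so a shifted trajectory is one again, and at the joint both
  one-sided derivatives are \<open>F\<close> of the common value.\<close>

lemma ode_solution_append:
  assumes x: "ode_solution F {0..T} x" and z: "ode_solution F {0..} z"
    and "x T = z 0" and "0 \<le> T"
  shows "ode_solution F {0..} (\<lambda>t. if t \<in> {0..T} then x t else z (t - T))"
  unfolding ode_solution_def
proof
  let ?y = "\<lambda>t. if t \<in> {0..T} then x t else z (t - T)"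
  fix t :: real assume t: "t \<in> {0..}"
  have z': "((\<lambda>t. z (t - T)) has_vector_derivative F (z (t - T))) (at t within {T..})"
    if "t \<in> {T..}" for t
  proof -
    have "(\<lambda>t. t - T) ` {T..} = {0..}"
      by (auto simp: image_iff intro!: bexI[of _ "_ + T"])
    then have "(z has_vector_derivative F (z (t - T))) (at (t - T) within (\<lambda>t. t - T) ` {T..})"
      using z that by (simp add: ode_solution_def)
    moreover have "((\<lambda>t. t - T) has_vector_derivative 1) (at t within {T..})"
      by (auto intro!: derivative_eq_intros)
    ultimately show ?thesis
      using vector_diff_chain_within[of "\<lambda>t. t - T" 1 t "{T..}" z "F (z (t - T))"]
      by (simp add: comp_def)
  qed
  have "(?y has_vector_derivative (if t \<in> {0..T} then F (x t) else F (z (t - T)))) (at t within {0..})"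
  proof (rule has_vector_derivative_If_within_closures[where T = "{T..}"])
    show "(x has_vector_derivative F (x t)) (at t within {0..T} \<union> closure {0..T} \<inter> closure {T..})"
      if "t \<in> {0..T} \<union> closure {0..T} \<inter> closure {T..}"
    proof -
      have "{0..T} \<union> closure {0..T} \<inter> closure {T..} = {0..T}" by auto
      then show ?thesis using x that by (simp add: ode_solution_def)
    qed
    show "((\<lambda>t. z (t - T)) has_vector_derivative F (z (t - T)))
            (at t within {T..} \<union> closure {0..T} \<inter> closure {T..})"
      if "t \<in> {T..} \<union> closure {0..T} \<inter> closure {T..}"
    proof -
      have "{T..} \<union> closure {0..T} \<inter> closure {T..} = {T..}" by auto
      then show ?thesis using z' that by simp
    qed
  qed (use assms t in auto)
  then show "(?y has_vector_derivative F (?y t)) (at t within {0..})"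
    by (cases "t \<in> {0..T}") auto
qed

text \<open>To make the field bounded, it is composed with the projection onto a ball whose interior
  contains \<open>C\<close>. The trajectories of the new field solve the original equation as long
  as they stay in the ball. At a first hitting time of the sphere, invariance would put the
  trajectory into \<open>C\<close>, hence strictly inside.\<close>

lemma ode_solution_exists_in_compact:
  fixes F :: "'a::euclidean_space \<Rightarrow> 'a"
  assumes cont: "continuous_on UNIV F" and C: "compact C" "x0 \<in> C"
    and inv: "\<And>b y. 0 \<le> b \<Longrightarrow> ode_solution F {0..b} y \<Longrightarrow> y 0 = x0 \<Longrightarrow> y b \<in> C"
  shows "\<exists>x. ode_solution F {0..} x \<and> x 0 = x0"
proof -
  obtain R where R: "C \<subseteq> ball 0 R"
    using C(1) bounded_subset_ballD compact_imp_bounded by blast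
  have "0 < R" using R C(2) by (metis ball_eq_empty empty_iff not_le subsetD)
  let ?P = "closest_point (cball 0 R :: 'a set)"
  have ne: "cball 0 R \<noteq> ({} :: 'a set)" using \<open>0 < R\<close> by simp
  have P_in: "?P z \<in> cball 0 R" for z
    using ne by (intro closest_point_in_set) auto
  obtain B where B: "\<And>z. z \<in> cball 0 R \<Longrightarrow> norm (F z) \<le> B"
  proof -
    have "compact (F ` cball 0 R)"
      using cont by (intro compact_continuous_image) (auto intro: continuous_on_subset)
    then obtain B where "\<forall>y \<in> F ` cball 0 R. norm y \<le> B"
      using compact_imp_bounded bounded_iff by metis
    then show ?thesis using that by blast
  qed
  have "continuous_on UNIV (\<lambda>z. F (?P z))"
    using ne by (intro continuous_on_compose2[OF cont] continuous_on_closest_point) auto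
  moreover have "norm (F (?P z)) \<le> B" for z
    using B P_in by blast
  ultimately obtain x where x: "ode_solution (\<lambda>z. F (?P z)) {0..} x" and x0: "x 0 = x0"
    using peano_global by blast
  have eq: "ode_solution F {0..b} x" if "\<And>r. r \<in> {0..b} \<Longrightarrow> norm (x r) \<le> R" for b
    using ode_solution_subset[OF x, of "{0..b}"] that
    by (auto simp: ode_solution_def closest_point_self)
  have x_ball: "norm (x t) < R" if t: "0 \<le> t" for t
  proof (rule ccontr)
    assume "\<not> norm (x t) < R"
    moreover have "norm (x 0) < R" using R C(2) x0 by auto
    moreover have "continuous_on {0..t} (\<lambda>r. norm (x r))"
      using ode_solution_continuous_on[OF x] by (intro continuous_intros) (auto elim: continuous_on_subset)
    ultimately obtain s where s: "s \<in> {0..t}" "norm (x s) = R" "\<And>r. r \<in> {0..s} \<Longrightarrow> norm (x r) \<le> R"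
      using first_hitting_time[of t "\<lambda>r. norm (x r)" R] t by (metis not_less)
    have "x s \<in> C"
      using inv[of s x] eq[OF s(3)] s(1) x0 by auto
    then show False using R s(2) by auto
  qed
  have "(x has_vector_derivative F (x t)) (at t within {0..})" if "0 \<le> t" for t
  proof -
    have "?P (x t) = x t"
      using x_ball[OF that] by (intro closest_point_self) simp
    then show ?thesis using bspec[OF x[unfolded ode_solution_def], of t] that by simp
  qed
  with x0 show ?thesis by (auto simp: ode_solution_def)
qed

text \<open>The given piece has bounded speed on its compact set, so it closes up at
  \<open>T\<close>. Its endpoint \<open>z\<close> is a new initial point with a compact set of its
  own and hence starts a global trajectory.\<close>

lemma ode_solution_extends_in_compact:
  fixes F :: "'a::euclidean_space \<Rightarrow> 'a"
  assumes cont: "continuous_on UNIV F"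
    and inv: "\<And>x0. \<exists>C. compact C \<and> x0 \<in> C \<and>
                 (\<forall>b y. 0 \<le> b \<longrightarrow> ode_solution F {0..b} y \<longrightarrow> y 0 = x0 \<longrightarrow> y b \<in> C)"
    and x: "ode_solution F {0..<T} x" and T: "0 < T"
  shows "\<exists>y. ode_solution F {0..} y \<and> (\<forall>t\<in>{0..<T}. y t = x t)"
proof -
  obtain C where C: "compact C" "\<And>b y. 0 \<le> b \<Longrightarrow> ode_solution F {0..b} y \<Longrightarrow> y 0 = x 0 \<Longrightarrow> y b \<in> C"
    using inv[of "x 0"] by blast
  have x_C: "x t \<in> C" if "t \<in> {0..<T}" for t
    using that by (intro C(2) ode_solution_subset[OF x]) auto
  have "compact (F ` C)"
    using cont C(1) by (intro compact_continuous_image) (auto intro: continuous_on_subset)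
  then obtain B where "\<forall>y \<in> F ` C. norm y \<le> B"
    using compact_imp_bounded bounded_iff by metis
  then obtain z where z: "ode_solution F {0..T} (\<lambda>t. if t < T then x t else z)"
    using ode_solution_extend_closed[OF cont x T, of B] x_C by blast
  obtain D where "compact D" "z \<in> D" "\<And>b y. 0 \<le> b \<Longrightarrow> ode_solution F {0..b} y \<Longrightarrow> y 0 = z \<Longrightarrow> y b \<in> D"
    using inv[of z] by blast
  then obtain y where y: "ode_solution F {0..} y" "y 0 = z"
    using ode_solution_exists_in_compact[OF cont] by metis
  show ?thesis
    using ode_solution_append[OF z y(1)] y(2) T by (intro exI conjI) auto
qed

subsection \<open>The quadratic program and its error bound\<close>

text \<open>Justifies the description operator in \<open>grad\<close>:
  \<open>adjoint \<phi>' 1\<close> represents the derivative through the inner product, and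
  uniqueness of the derivative makes the representative unique.\<close>

lemma grad_has_derivative:
  fixes \<phi> :: "real ^ 'n \<Rightarrow> real"
  assumes "\<phi> differentiable (at x)"
  shows "(\<phi> has_derivative (\<lambda>d. grad \<phi> x \<bullet> d)) (at x)"
proof -
  obtain \<phi>' where \<phi>': "(\<phi> has_derivative \<phi>') (at x)"
    using assms unfolding differentiable_def by blast
  then have lin: "linear \<phi>'" by (rule has_derivative_linear)
  have "\<phi>' d = d \<bullet> adjoint \<phi>' 1" for d
    using adjoint_works[OF lin, of d 1] by simp
  then have "\<phi>' = (\<lambda>d. d \<bullet> adjoint \<phi>' 1)" by blast
  with \<phi>' have "GDERIV \<phi> x :> adjoint \<phi>' 1"
    by (simp add: gderiv_def)
  moreover have "D = D'" if "GDERIV \<phi> x :> D" "GDERIV \<phi> x :> D'" for D D'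
  proof -
    have "(\<lambda>d. d \<bullet> D) = (\<lambda>d. d \<bullet> D')"
      using that unfolding gderiv_def by (rule has_derivative_unique)
    then have "\<forall>d. d \<bullet> D = d \<bullet> D'" by (simp add: fun_eq_iff)
    then show ?thesis by (simp add: vector_eq_ldot)
  qed
  ultimately have "\<exists>!D. GDERIV \<phi> x :> D"
    by blast
  then have "GDERIV \<phi> x :> grad \<phi> x"
    unfolding grad_def by (rule theI')
  then show ?thesis
    by (simp add: gderiv_def inner_commute)
qed

lemma diff_loc_lipschitz_deriv_continuous_on:
  assumes "diff_loc_lipschitz_deriv \<phi>"
  shows "continuous_on UNIV \<phi>" and "continuous_on UNIV (grad \<phi>)"
proof -
  show "continuous_on UNIV \<phi>"
    using assms unfolding diff_loc_lipschitz_deriv_def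
    by (simp add: continuous_at_imp_continuous_on differentiable_imp_continuous_within)
  show "continuous_on UNIV (grad \<phi>)"
    using assms unfolding diff_loc_lipschitz_deriv_def
    by (intro local_lipschitz_continuous_on[where t = 0]) auto
qed

lemma has_real_derivative_along_solution:
  fixes \<phi> :: "real ^ 'n \<Rightarrow> real"
  assumes "diff_loc_lipschitz_deriv \<phi>" and "ode_solution F J x" and "t \<in> J"
  shows "((\<lambda>t. \<phi> (x t)) has_real_derivative grad \<phi> (x t) \<bullet> F (x t)) (at t within J)"
proof -
  have "(\<phi> has_derivative (\<lambda>d. grad \<phi> (x t) \<bullet> d)) (at (x t))"
    using assms(1) by (intro grad_has_derivative) (simp add: diff_loc_lipschitz_deriv_def)
  moreover have "(x has_derivative (\<lambda>d. d *\<^sub>R F (x t))) (at t within J)"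
    using assms(2,3) by (simp add: ode_solution_def has_vector_derivative_def)
  ultimately have "((\<lambda>t. \<phi> (x t)) has_derivative (\<lambda>d. grad \<phi> (x t) \<bullet> (d *\<^sub>R F (x t)))) (at t within J)"
    by (rule has_derivative_compose[rotated])
  then show ?thesis
    by (simp add: has_field_derivative_def mult_commute_abs)
qed

text \<open>Counting dimensions shows that the \<open>a j\<close> are distinct and independent. Each
  coordinate functional then extends to the whole space, and \<open>adjoint\<close> turns it into a
  vector.\<close>

lemma obtain_dual_family:
  fixes a :: "'i \<Rightarrow> 'a::euclidean_space"
  assumes "finite J" and dim: "dim (span (a ` J)) = card J"
  obtains w where "\<And>j k. j \<in> J \<Longrightarrow> k \<in> J \<Longrightarrow> a j \<bullet> w k = (if j = k then 1 else 0)"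
proof -
  have le: "card (a ` J) \<le> card J" using assms(1) by (rule card_image_le)
  have "dim (a ` J) \<le> card (a ` J)" using assms(1) by (intro dim_le_card') auto
  with dim le have card: "card (a ` J) = card J" by simp
  then have inj: "inj_on a J" using assms(1) by (intro eq_card_imp_inj_on)
  have ind: "independent (a ` J)"
    using assms(1) card dim by (intro card_le_dim_spanning[of _ "span (a ` J)"]) (auto intro: span_base)
  have "\<exists>w. \<forall>j\<in>J. a j \<bullet> w = (if j = k then 1 else 0)" if k: "k \<in> J" for k
  proof -
    obtain \<phi> :: "'a \<Rightarrow> real" where lin: "linear \<phi>"
      and \<phi>: "\<forall>y \<in> a ` J. \<phi> y = (if y = a k then 1 else 0)"
      using linear_independent_extend[OF ind, of "\<lambda>y. if y = a k then 1 else 0"] by blast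
    have "a j \<bullet> adjoint \<phi> 1 = (if j = k then 1 else 0)" if "j \<in> J" for j
      using adjoint_works[OF lin, of "a j" 1] \<phi> that k inj by (auto simp: inj_on_def)
    then show ?thesis by blast
  qed
  then show ?thesis using that by metis
qed

text \<open>The map \<open>L\<close> below is a perturbation of the identity that turns the system for \<open>b\<close> into the
  one for \<open>a\<close>, which the dual family solves explicitly.\<close>

lemma perturbed_system_solvable:
  fixes a b w :: "'i \<Rightarrow> 'a::euclidean_space"
  assumes "finite J"
    and dual: "\<And>j k. j \<in> J \<Longrightarrow> k \<in> J \<Longrightarrow> a j \<bullet> w k = (if j = k then 1 else 0)"
    and close: "(\<Sum>j\<in>J. norm (b j - a j) * norm (w j)) \<le> 1 / 2"
  obtains z where "\<And>j. j \<in> J \<Longrightarrow> b j \<bullet> z = r j"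
    and "norm z \<le> 2 * (\<Sum>j\<in>J. norm (w j)) * (\<Sum>j\<in>J. \<bar>r j\<bar>)"
proof -
  define L where "L y = y + (\<Sum>j\<in>J. ((b j - a j) \<bullet> y) *\<^sub>R w j)" for y
  have "linear L"
    by (rule linearI)
      (simp_all add: L_def inner_add_right scaleR_add_left scaleR_add_right scaleR_sum_right sum.distrib)
  \<comment> \<open>The correction in \<open>L\<close> is at most half of \<open>norm y\<close>;
    this gives injectivity and the factor 2 in the bound on \<open>z\<close>.\<close>
  have lower: "norm y \<le> 2 * norm (L y)" for y
  proof -
    have "norm (\<Sum>j\<in>J. ((b j - a j) \<bullet> y) *\<^sub>R w j) \<le> (\<Sum>j\<in>J. norm (b j - a j) * norm (w j) * norm y)"
    proof (rule sum_norm_le)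
      fix j
      have "norm (((b j - a j) \<bullet> y) *\<^sub>R w j) \<le> (norm (b j - a j) * norm y) * norm (w j)"
        unfolding norm_scaleR real_norm_def by (intro mult_right_mono Cauchy_Schwarz_ineq2) auto
      then show "norm (((b j - a j) \<bullet> y) *\<^sub>R w j) \<le> norm (b j - a j) * norm (w j) * norm y"
        by (simp add: mult_ac)
    qed
    also have "\<dots> \<le> 1 / 2 * norm y"
      unfolding sum_distrib_right[symmetric] using close by (intro mult_right_mono) auto
    finally show ?thesis
      using norm_triangle_ineq2[of y "- (\<Sum>j\<in>J. ((b j - a j) \<bullet> y) *\<^sub>R w j)"]
      by (simp add: L_def)
  qed
  have "inj L"
    unfolding linear_injective_0[OF \<open>linear L\<close>]
  proof (intro allI impI)
    fix y assume "L y = 0"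
    then show "y = 0" using lower[of y] by simp
  qed
  then have "surj L"
    using \<open>linear L\<close> by (simp add: linear_injective_imp_surjective)
  then obtain z where z: "L z = (\<Sum>j\<in>J. r j *\<^sub>R w j)"
    by (metis surjD)
  have "b k \<bullet> z = r k" if k: "k \<in> J" for k
  proof -
    have pick: "a k \<bullet> (\<Sum>j\<in>J. c j *\<^sub>R w j) = c k" for c
    proof -
      have "a k \<bullet> (\<Sum>j\<in>J. c j *\<^sub>R w j) = (\<Sum>j\<in>J. if k = j then c j else 0)"
        using dual k by (auto simp: inner_sum_right intro!: sum.cong)
      then show ?thesis using assms(1) k by simp
    qed
    have "a k \<bullet> L z = r k"
      unfolding z by (rule pick)
    \<comment> \<open>Since \<open>a k\<close> picks the k-th coefficient of the correction,
      \<open>a k \<bullet> L z\<close> is just \<open>b k \<bullet> z\<close>.\<close>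
    moreover have "a k \<bullet> L z = a k \<bullet> z + (b k - a k) \<bullet> z"
      unfolding L_def inner_add_right by (simp only: pick)
    ultimately show ?thesis by (simp add: inner_diff_left)
  qed
  moreover have "norm z \<le> 2 * (\<Sum>j\<in>J. norm (w j)) * (\<Sum>j\<in>J. \<bar>r j\<bar>)"
  proof -
    have "norm (L z) \<le> (\<Sum>j\<in>J. \<bar>r j\<bar> * norm (w j))"
      unfolding z by (intro sum_norm_le) simp
    also have "\<dots> \<le> (\<Sum>j\<in>J. \<bar>r j\<bar> * (\<Sum>j\<in>J. norm (w j)))"
      using assms(1) by (intro sum_mono mult_left_mono member_le_sum) auto
    also have "\<dots> = (\<Sum>j\<in>J. norm (w j)) * (\<Sum>j\<in>J. \<bar>r j\<bar>)"
      by (simp add: sum_distrib_right[symmetric] mult.commute)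
    finally show ?thesis using lower[of z] by simp
  qed
  ultimately show ?thesis using that by blast
qed

section \<open>Residuals, projection property and Slater points of (QP)\<close>

locale qp_mfcq =
  fixes f :: "real ^ 'n \<Rightarrow> real" and g h :: "nat \<Rightarrow> real ^ 'n \<Rightarrow> real" and m l :: nat and \<alpha> :: real
  assumes f_smooth: "diff_loc_lipschitz_deriv f"
    and g_smooth: "\<And>i. i \<in> {1..m} \<Longrightarrow> diff_loc_lipschitz_deriv (g i)"
    and h_smooth: "\<And>j. j \<in> {1..l} \<Longrightarrow> diff_loc_lipschitz_deriv (h j)"
    and alpha_pos: "\<alpha> > 0"
    and mfcq: "\<And>\<theta>. mfcq_qp \<alpha> f m g l h \<theta>"
begin

abbreviation G :: "real ^ 'n \<Rightarrow> real ^ 'n" where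
  "G \<equiv> safe_gradient_flow \<alpha> f m g l h"

abbreviation feasible :: "real ^ 'n \<Rightarrow> real ^ 'n \<Rightarrow> bool" where
  "feasible \<equiv> qp_feasible \<alpha> m g l h"

definition ineq_residual :: "nat \<Rightarrow> real ^ 'n \<Rightarrow> real ^ 'n \<Rightarrow> real" where
  "ineq_residual i \<theta> \<xi> = grad (g i) \<theta> \<bullet> \<xi> + \<alpha> * g i \<theta>"

definition eq_residual :: "nat \<Rightarrow> real ^ 'n \<Rightarrow> real ^ 'n \<Rightarrow> real" where
  "eq_residual j \<theta> \<xi> = grad (h j) \<theta> \<bullet> \<xi> + \<alpha> * h j \<theta>"

text \<open>At \<open>\<xi> = 0\<close> this is \<alpha> times the summed constraint violation of
  (NLP) at \<theta>, so one function measures infeasibility for both problems.\<close>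

definition violation :: "real ^ 'n \<Rightarrow> real ^ 'n \<Rightarrow> real" where
  "violation \<theta> \<xi> = (\<Sum>i\<in>{1..m}. max 0 (ineq_residual i \<theta> \<xi>)) + (\<Sum>j\<in>{1..l}. \<bar>eq_residual j \<theta> \<xi>\<bar>)"

lemma feasible_iff:
  "feasible \<theta> \<xi> \<longleftrightarrow> (\<forall>i\<in>{1..m}. ineq_residual i \<theta> \<xi> \<le> 0) \<and> (\<forall>j\<in>{1..l}. eq_residual j \<theta> \<xi> = 0)"
  by (auto simp: qp_feasible_def ineq_residual_def eq_residual_def add_eq_0_iff algebra_simps)

lemma violation_nonneg: "0 \<le> violation \<theta> \<xi>"
  unfolding violation_def by (intro add_nonneg_nonneg sum_nonneg) auto

lemma violation_feasible: "feasible \<theta> \<xi> \<Longrightarrow> violation \<theta> \<xi> = 0"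
  unfolding violation_def feasible_iff by (simp add: max_absorb1)

lemma ineq_residual_le_violation: "i \<in> {1..m} \<Longrightarrow> ineq_residual i \<theta> \<xi> \<le> violation \<theta> \<xi>"
proof -
  assume "i \<in> {1..m}"
  then have "max 0 (ineq_residual i \<theta> \<xi>) \<le> (\<Sum>i\<in>{1..m}. max 0 (ineq_residual i \<theta> \<xi>))"
    by (intro member_le_sum) auto
  moreover have "0 \<le> (\<Sum>j\<in>{1..l}. \<bar>eq_residual j \<theta> \<xi>\<bar>)"
    by (intro sum_nonneg) auto
  ultimately show ?thesis unfolding violation_def by linarith
qed

lemma eq_residual_sum_le_violation: "(\<Sum>j\<in>{1..l}. \<bar>eq_residual j \<theta> \<xi>\<bar>) \<le> violation \<theta> \<xi>"
  unfolding violation_def by (simp add: sum_nonneg)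

lemma G_is_arg_min: "is_arg_min (qp_objective f \<theta>) (feasible \<theta>) (G \<theta>)"
proof -
  have "\<exists>\<xi>. is_arg_min (qp_objective f \<theta>) (feasible \<theta>) \<xi>"
    using mfcq[of \<theta>] unfolding mfcq_qp_def by blast
  then show ?thesis
    unfolding safe_gradient_flow_def arg_min_def by (rule someI_ex)
qed

lemma G_feasible: "feasible \<theta> (G \<theta>)"
  using G_is_arg_min by (simp add: is_arg_min_def)

text \<open>The point has the shape needed for the error bound: a convex combination with a Slater
  point plus a correction. With \<open>z = 0\<close> it yields convexity of the feasible
  set.\<close>

lemma ineq_residual_affine:
  "ineq_residual i \<theta> (\<xi> + t *\<^sub>R (\<xi>' - \<xi>) + z)
     = (1 - t) * ineq_residual i \<theta> \<xi> + t * ineq_residual i \<theta> \<xi>' + grad (g i) \<theta> \<bullet> z"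
  by (simp add: ineq_residual_def inner_add_right inner_diff_right algebra_simps)

lemma eq_residual_affine:
  "eq_residual j \<theta> (\<xi> + t *\<^sub>R (\<xi>' - \<xi>) + z)
     = (1 - t) * eq_residual j \<theta> \<xi> + t * eq_residual j \<theta> \<xi>' + grad (h j) \<theta> \<bullet> z"
  by (simp add: eq_residual_def inner_add_right inner_diff_right algebra_simps)

lemma convex_feasible: "convex {\<xi>. feasible \<theta> \<xi>}"
proof (rule convexI)
  fix x y and u v :: real
  assume *: "x \<in> {\<xi>. feasible \<theta> \<xi>}" "y \<in> {\<xi>. feasible \<theta> \<xi>}" "0 \<le> u" "0 \<le> v" "u + v = 1"
  then have "u *\<^sub>R x + v *\<^sub>R y = x + v *\<^sub>R (y - x) + 0"
    by (simp add: algebra_simps flip: scaleR_add_left)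
  then show "u *\<^sub>R x + v *\<^sub>R y \<in> {\<xi>. feasible \<theta> \<xi>}"
    using * by (simp only: mem_Collect_eq feasible_iff ineq_residual_affine eq_residual_affine)
      (auto intro!: add_nonpos_nonpos mult_nonneg_nonpos)
qed

lemma closed_feasible: "closed {\<xi>. feasible \<theta> \<xi>}"
proof -
  have "{\<xi>. feasible \<theta> \<xi>} = (\<Inter>i\<in>{1..m}. {\<xi>. grad (g i) \<theta> \<bullet> \<xi> \<le> - \<alpha> * g i \<theta>})
      \<inter> (\<Inter>j\<in>{1..l}. {\<xi>. grad (h j) \<theta> \<bullet> \<xi> = - \<alpha> * h j \<theta>})"
    by (auto simp: qp_feasible_def)
  then show ?thesis
    by (auto intro!: closed_Int closed_INT closed_halfspace_le closed_hyperplane)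
qed

text \<open>\<open>G \<theta>\<close> is the projection of \<open>- grad f \<theta>\<close> onto the
  closed convex feasible set, and projections are characterised by obtuse angles.\<close>

lemma G_variational_inequality:
  assumes "feasible \<theta> \<xi>"
  shows "0 \<le> (G \<theta> + grad f \<theta>) \<bullet> (\<xi> - G \<theta>)"
proof -
  have "dist (- grad f \<theta>) (G \<theta>) \<le> dist (- grad f \<theta>) z" if "feasible \<theta> z" for z
  proof -
    have "qp_objective f \<theta> (G \<theta>) \<le> qp_objective f \<theta> z"
      using G_is_arg_min that by (simp add: is_arg_min_linorder)
    then have "norm (G \<theta> + grad f \<theta>) \<le> norm (z + grad f \<theta>)"
      by (simp add: qp_objective_def)
    moreover have "dist (- grad f \<theta>) z = norm (z + grad f \<theta>)" for z
      by (metis add.commute diff_minus_eq_add dist_commute dist_norm)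
    ultimately show ?thesis by simp
  qed
  then have "(- grad f \<theta> - G \<theta>) \<bullet> (\<xi> - G \<theta>) \<le> 0"
    using any_closest_point_dot[OF convex_feasible closed_feasible, of "G \<theta>" \<theta> \<xi> "- grad f \<theta>"]
      G_feasible assms by simp
  then show ?thesis
    by (simp add: inner_diff_left inner_add_left)
qed

text \<open>A short step from the minimiser along the MFCQ direction \<open>d\<close>: active
  constraints become strict, inactive ones stay strict by continuity, and the equality residuals do
  not change.\<close>

lemma slater_point:
  obtains \<xi> where "\<And>i. i \<in> {1..m} \<Longrightarrow> ineq_residual i \<theta> \<xi> < 0"
    and "\<And>j. j \<in> {1..l} \<Longrightarrow> eq_residual j \<theta> \<xi> = 0"
proof -
  obtain \<xi> d where min: "is_arg_min (qp_objective f \<theta>) (feasible \<theta>) \<xi>"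
    and d: "\<forall>j\<in>{1..l}. grad (h j) \<theta> \<bullet> d = 0"
      "\<forall>i\<in>{i\<in>{1..m}. grad (g i) \<theta> \<bullet> \<xi> + \<alpha> * g i \<theta> = 0}. grad (g i) \<theta> \<bullet> d < 0"
    using mfcq[of \<theta>] unfolding mfcq_qp_def by blast
  have feas: "feasible \<theta> \<xi>" using min by (simp add: is_arg_min_def)
  have "eventually (\<lambda>\<epsilon>. ineq_residual i \<theta> (\<xi> + \<epsilon> *\<^sub>R d) < 0) (at_right 0)" if i: "i \<in> {1..m}" for i
  proof (cases "ineq_residual i \<theta> \<xi> = 0")
    case True
    then have neg: "grad (g i) \<theta> \<bullet> d < 0" using d(2) i by (auto simp: ineq_residual_def)
    have "ineq_residual i \<theta> (\<xi> + \<epsilon> *\<^sub>R d) < 0" if "0 < \<epsilon>" for \<epsilon>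
    proof -
      have "ineq_residual i \<theta> (\<xi> + \<epsilon> *\<^sub>R d) = \<epsilon> * (grad (g i) \<theta> \<bullet> d)"
        using True by (simp add: ineq_residual_def inner_add_right)
      then show ?thesis using neg that by (simp add: mult_pos_neg)
    qed
    then show ?thesis by (rule eventually_mono[OF eventually_at_right_less])
  next
    case False
    then have "ineq_residual i \<theta> \<xi> < 0" using feas i by (force simp: feasible_iff)
    moreover have "((\<lambda>\<epsilon>. ineq_residual i \<theta> (\<xi> + \<epsilon> *\<^sub>R d)) \<longlongrightarrow> ineq_residual i \<theta> (\<xi> + 0 *\<^sub>R d)) (at_right 0)"
      unfolding ineq_residual_def by (intro tendsto_intros)
    ultimately show ?thesis by (auto dest: order_tendstoD(2))
  qed
  then have "eventually (\<lambda>\<epsilon>. \<forall>i\<in>{1..m}. ineq_residual i \<theta> (\<xi> + \<epsilon> *\<^sub>R d) < 0) (at_right 0)"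
    by (intro eventually_ball_finite) auto
  then obtain \<epsilon> :: real where "\<forall>i\<in>{1..m}. ineq_residual i \<theta> (\<xi> + \<epsilon> *\<^sub>R d) < 0"
    using eventually_happens trivial_limit_at_right_real by blast
  moreover have "eq_residual j \<theta> (\<xi> + \<epsilon> *\<^sub>R d) = 0" if "j \<in> {1..l}" for j
    using feas d(1) that by (simp add: feasible_iff eq_residual_def inner_add_right)
  ultimately show ?thesis using that by blast
qed

section \<open>Continuity of the data and uniform constants on compact sets\<close>

lemma tendsto_data:
  assumes "(F \<longlongrightarrow> \<theta>) A"
  shows "((\<lambda>x. grad f (F x)) \<longlongrightarrow> grad f \<theta>) A"
    and "i \<in> {1..m} \<Longrightarrow> ((\<lambda>x. g i (F x)) \<longlongrightarrow> g i \<theta>) A"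
    and "i \<in> {1..m} \<Longrightarrow> ((\<lambda>x. grad (g i) (F x)) \<longlongrightarrow> grad (g i) \<theta>) A"
    and "j \<in> {1..l} \<Longrightarrow> ((\<lambda>x. h j (F x)) \<longlongrightarrow> h j \<theta>) A"
    and "j \<in> {1..l} \<Longrightarrow> ((\<lambda>x. grad (h j) (F x)) \<longlongrightarrow> grad (h j) \<theta>) A"
proof -
  note cont = diff_loc_lipschitz_deriv_continuous_on
  show "((\<lambda>x. grad f (F x)) \<longlongrightarrow> grad f \<theta>) A"
    by (rule continuous_on_tendsto_compose[OF cont(2)[OF f_smooth] assms]) auto
  show "((\<lambda>x. g i (F x)) \<longlongrightarrow> g i \<theta>) A" "((\<lambda>x. grad (g i) (F x)) \<longlongrightarrow> grad (g i) \<theta>) A"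
    if "i \<in> {1..m}"
    using cont[OF g_smooth[OF that]] by (auto intro: continuous_on_tendsto_compose[OF _ assms])
  show "((\<lambda>x. h j (F x)) \<longlongrightarrow> h j \<theta>) A" "((\<lambda>x. grad (h j) (F x)) \<longlongrightarrow> grad (h j) \<theta>) A"
    if "j \<in> {1..l}"
    using cont[OF h_smooth[OF that]] by (auto intro: continuous_on_tendsto_compose[OF _ assms])
qed

lemma tendsto_residuals:
  assumes "(F \<longlongrightarrow> \<theta>) A"
  shows "i \<in> {1..m} \<Longrightarrow> ((\<lambda>x. ineq_residual i (F x) \<xi>) \<longlongrightarrow> ineq_residual i \<theta> \<xi>) A"
    and "j \<in> {1..l} \<Longrightarrow> ((\<lambda>x. eq_residual j (F x) \<xi>) \<longlongrightarrow> eq_residual j \<theta> \<xi>) A"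
proof -
  show "((\<lambda>x. ineq_residual i (F x) \<xi>) \<longlongrightarrow> ineq_residual i \<theta> \<xi>) A" if i: "i \<in> {1..m}"
    unfolding ineq_residual_def
    by (intro tendsto_add tendsto_inner tendsto_mult tendsto_const tendsto_data(2,3)[OF assms i])
  show "((\<lambda>x. eq_residual j (F x) \<xi>) \<longlongrightarrow> eq_residual j \<theta> \<xi>) A" if j: "j \<in> {1..l}"
    unfolding eq_residual_def
    by (intro tendsto_add tendsto_inner tendsto_mult tendsto_const tendsto_data(4,5)[OF assms j])
qed

lemma tendsto_violation:
  assumes "(F \<longlongrightarrow> \<theta>) A"
  shows "((\<lambda>x. violation (F x) \<xi>) \<longlongrightarrow> violation \<theta> \<xi>) A"
  unfolding violation_def
  by (intro tendsto_add tendsto_sum tendsto_max tendsto_const tendsto_rabs tendsto_residuals[OF assms])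

end

text \<open>Local constants are merged through a finite subcover; monotonicity in the constant lets
  the sum of their absolute values serve everywhere.\<close>

lemma compact_uniform_constant:
  fixes P :: "real \<Rightarrow> 'a::topological_space \<Rightarrow> bool"
  assumes "compact C" and loc: "\<And>x. x \<in> C \<Longrightarrow> \<exists>K. eventually (P K) (nhds x)"
    and mono: "\<And>K L y. P K y \<Longrightarrow> K \<le> L \<Longrightarrow> P L y"
  obtains K where "0 \<le> K" "\<And>y. y \<in> C \<Longrightarrow> P K y"
proof -
  have "\<forall>x\<in>C. \<exists>K U. open U \<and> x \<in> U \<and> (\<forall>y\<in>U. P K y)"
    using loc unfolding eventually_nhds by blast
  from bchoice[OF this] obtain k
    where "\<forall>x\<in>C. \<exists>U. open U \<and> x \<in> U \<and> (\<forall>y\<in>U. P (k x) y)" by blast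
  from bchoice[OF this] obtain U
    where U: "\<forall>x\<in>C. open (U x) \<and> x \<in> U x \<and> (\<forall>y\<in>U x. P (k x) y)" by blast
  have opens: "open (U c)" if "c \<in> C" for c using U that by simp
  have cover: "C \<subseteq> (\<Union>c\<in>C. U c)" using U by auto
  obtain D where D: "D \<subseteq> C" "finite D" "C \<subseteq> (\<Union>c\<in>D. U c)"
    by (rule compactE_image[OF assms(1) opens cover])
  let ?K = "\<Sum>c\<in>D. \<bar>k c\<bar>"
  have "P ?K y" if y: "y \<in> C" for y
  proof -
    obtain c where c: "c \<in> D" "y \<in> U c" using D(3) y by blast
    have "\<bar>k c\<bar> \<le> ?K" using D(2) c(1) by (intro member_le_sum) auto
    then have "k c \<le> ?K" by linarith
    moreover have "P (k c) y" using U c D(1) by auto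
    ultimately show ?thesis by (rule mono[rotated])
  qed
  moreover have "0 \<le> ?K" by (intro sum_nonneg) auto
  ultimately show ?thesis using that by blast
qed

context qp_mfcq
begin

text \<open>Move \<open>\<xi>\<close> towards a Slater point by the fraction \<open>t\<close>, and repair the equality constraints by a
  correction \<open>z\<close> that is small enough not to use up the slack gained.\<close>

lemma error_bound_at:
  assumes "0 < \<mu>" "0 \<le> c"
    and slack: "\<And>i. i \<in> {1..m} \<Longrightarrow> ineq_residual i \<theta> \<xi>s \<le> - \<mu>"
    and grad_le: "\<And>i. i \<in> {1..m} \<Longrightarrow> norm (grad (g i) \<theta>) \<le> c"
    and dual: "\<And>j k. j \<in> {1..l} \<Longrightarrow> k \<in> {1..l} \<Longrightarrow> a j \<bullet> w k = (if j = k then 1 else 0)"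
    and close: "(\<Sum>j\<in>{1..l}. norm (grad (h j) \<theta> - a j) * norm (w j)) \<le> 1 / 2"
    and W: "W = 2 * (\<Sum>j\<in>{1..l}. norm (w j))"
    and \<sigma>1: "(\<Sum>j\<in>{1..l}. \<bar>eq_residual j \<theta> \<xi>s\<bar>) \<le> 1"
    and \<sigma>2: "c * W * (\<Sum>j\<in>{1..l}. \<bar>eq_residual j \<theta> \<xi>s\<bar>) \<le> \<mu> / 2"
    and T: "T = 2 * (1 + c * W) / \<mu>"
  shows "\<exists>\<xi>'. feasible \<theta> \<xi>' \<and>
           norm (\<xi>' - \<xi>) \<le> (T * (norm \<xi>s + W + 1) + W) * (1 + norm \<xi>) * violation \<theta> \<xi>"
proof -
  define \<rho> where "\<rho> = violation \<theta> \<xi>"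
  define \<sigma> where "\<sigma> = (\<Sum>j\<in>{1..l}. \<bar>eq_residual j \<theta> \<xi>s\<bar>)"
  \<comment> \<open>The size of \<open>T\<close> comes from the inequality constraints. Moving by
    \<open>t\<close> gains \<open>t * \<mu>\<close>: one half pays for the part
    \<open>c * W * t * \<sigma>\<close> of the correction, the other for
    \<open>(1 - t) * \<rho> * (1 + c * W)\<close>. The latter vanishes if \<open>t = 1\<close>, and
    otherwise is at most \<open>\<rho> * (1 + c * W) = t * (\<mu> / 2)\<close>.\<close>
  define t where "t = min 1 (T * \<rho>)"
  have \<rho>: "0 \<le> \<rho>" unfolding \<rho>_def by (rule violation_nonneg)
  have W0: "0 \<le> W" unfolding W by (simp add: sum_nonneg)
  have T0: "0 \<le> T" unfolding T using assms(1,2) W0 by simp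
  have \<sigma>0: "0 \<le> \<sigma>" unfolding \<sigma>_def by (simp add: sum_nonneg)
  have t: "0 \<le> t" "t \<le> 1" "t \<le> T * \<rho>" using T0 \<rho> by (auto simp: t_def)
  \<comment> \<open>The equality residual left by the convex combination, with the sign that
    \<open>z\<close> has to contribute.\<close>
  define r where "r j = - ((1 - t) * eq_residual j \<theta> \<xi> + t * eq_residual j \<theta> \<xi>s)" for j
  obtain z where z: "\<And>j. j \<in> {1..l} \<Longrightarrow> grad (h j) \<theta> \<bullet> z = r j"
    and z_le: "norm z \<le> 2 * (\<Sum>j\<in>{1..l}. norm (w j)) * (\<Sum>j\<in>{1..l}. \<bar>r j\<bar>)"
    using perturbed_system_solvable[OF _ dual close, of r] by auto
  have "(\<Sum>j\<in>{1..l}. \<bar>r j\<bar>) \<le> (\<Sum>j\<in>{1..l}. (1 - t) * \<bar>eq_residual j \<theta> \<xi>\<bar> + t * \<bar>eq_residual j \<theta> \<xi>s\<bar>)"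
  proof (rule sum_mono)
    fix j
    show "\<bar>r j\<bar> \<le> (1 - t) * \<bar>eq_residual j \<theta> \<xi>\<bar> + t * \<bar>eq_residual j \<theta> \<xi>s\<bar>"
      unfolding r_def abs_minus_cancel using t
      by (intro order_trans[OF abs_triangle_ineq]) (simp add: abs_mult)
  qed
  also have "\<dots> = (1 - t) * (\<Sum>j\<in>{1..l}. \<bar>eq_residual j \<theta> \<xi>\<bar>) + t * \<sigma>"
    unfolding \<sigma>_def sum.distrib sum_distrib_left ..
  also have "\<dots> \<le> (1 - t) * \<rho> + t * \<sigma>"
    unfolding \<rho>_def using t by (intro add_right_mono mult_left_mono eq_residual_sum_le_violation) auto
  finally have r_le: "(\<Sum>j\<in>{1..l}. \<bar>r j\<bar>) \<le> (1 - t) * \<rho> + t * \<sigma>" .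
  have z_bound: "norm z \<le> W * ((1 - t) * \<rho> + t * \<sigma>)"
    using z_le mult_left_mono[OF r_le W0] unfolding W by linarith
  define \<xi>' where "\<xi>' = \<xi> + t *\<^sub>R (\<xi>s - \<xi>) + z"
  have "feasible \<theta> \<xi>'"
    unfolding feasible_iff
  proof (intro conjI ballI)
    fix j assume "j \<in> {1..l}"
    then show "eq_residual j \<theta> \<xi>' = 0"
      unfolding \<xi>'_def eq_residual_affine using z[of j] by (simp add: r_def)
  next
    fix i assume i: "i \<in> {1..m}"
    have "grad (g i) \<theta> \<bullet> z \<le> c * (W * ((1 - t) * \<rho> + t * \<sigma>))"
      using norm_cauchy_schwarz[of "grad (g i) \<theta>" z]
        mult_mono[OF grad_le[OF i] z_bound \<open>0 \<le> c\<close> norm_ge_zero] by linarith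
    moreover have "(1 - t) * ineq_residual i \<theta> \<xi> \<le> (1 - t) * \<rho>"
      unfolding \<rho>_def using t ineq_residual_le_violation[OF i] by (intro mult_left_mono) auto
    moreover have "t * ineq_residual i \<theta> \<xi>s \<le> t * (- \<mu>)"
      using t slack[OF i] by (intro mult_left_mono) auto
    moreover have "t * (c * W * \<sigma>) \<le> t * (\<mu> / 2)"
      using t \<sigma>2 unfolding \<sigma>_def by (intro mult_left_mono) auto
    moreover have "(1 - t) * \<rho> * (1 + c * W) \<le> t * (\<mu> / 2)"
    proof (cases "t = 1")
      case False
      then have "t = T * \<rho>" by (simp add: t_def min_def split: if_splits)
      then have "t * (\<mu> / 2) = \<rho> * (1 + c * W)"
        unfolding T using \<open>0 < \<mu>\<close> by (simp add: field_simps)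
      moreover have "(1 - t) * \<rho> * (1 + c * W) \<le> 1 * \<rho> * (1 + c * W)"
        using t \<rho> \<open>0 \<le> c\<close> W0 by (intro mult_right_mono) auto
      ultimately show ?thesis by simp
    qed (use \<open>0 < \<mu>\<close> in simp)
    ultimately show "ineq_residual i \<theta> \<xi>' \<le> 0"
      unfolding \<xi>'_def ineq_residual_affine by (simp add: algebra_simps)
  qed
  moreover have "norm (\<xi>' - \<xi>) \<le> (T * (norm \<xi>s + W + 1) + W) * (1 + norm \<xi>) * \<rho>"
  proof -
    have "norm (\<xi>' - \<xi>) \<le> t * (norm \<xi>s + norm \<xi>) + norm z"
      unfolding \<xi>'_def
      using norm_triangle_ineq[of "t *\<^sub>R (\<xi>s - \<xi>)" z] norm_triangle_ineq4[of \<xi>s \<xi>] t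
        mult_left_mono[OF norm_triangle_ineq4[of \<xi>s \<xi>], of t]
      by (simp add: add.assoc)
    also have "norm z \<le> W * (\<rho> + t)"
    proof -
      have "(1 - t) * \<rho> + t * \<sigma> \<le> 1 * \<rho> + t * 1"
        using t \<rho> \<sigma>1 by (intro add_mono mult_right_mono mult_left_mono) (auto simp: \<sigma>_def)
      then have "(1 - t) * \<rho> + t * \<sigma> \<le> \<rho> + t" by simp
      from mult_left_mono[OF this W0] z_bound show ?thesis by linarith
    qed
    also have "t * (norm \<xi>s + norm \<xi>) + W * (\<rho> + t) = t * (norm \<xi>s + norm \<xi> + W) + W * \<rho>"
      by (simp add: algebra_simps)
    also have "\<dots> \<le> (T * \<rho>) * ((norm \<xi>s + W + 1) * (1 + norm \<xi>)) + W * (1 + norm \<xi>) * \<rho>"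
    proof (intro add_mono mult_mono)
      have "0 \<le> norm \<xi>s * norm \<xi>" "0 \<le> W * norm \<xi>" using W0 by auto
      then show "norm \<xi>s + norm \<xi> + W \<le> (norm \<xi>s + W + 1) * (1 + norm \<xi>)"
        by (simp add: algebra_simps)
      show "W \<le> W * (1 + norm \<xi>)" using W0 by (simp add: algebra_simps)
    qed (use t T0 W0 \<rho> in auto)
    also have "\<dots> = (T * (norm \<xi>s + W + 1) + W) * (1 + norm \<xi>) * \<rho>"
      by (simp add: algebra_simps)
    finally show ?thesis by simp
  qed
  ultimately show ?thesis unfolding \<rho>_def by blast
qed

text \<open>Slater point and dual family are chosen at \<theta>0. The inequalities that
  \<open>error_bound_at\<close> asks for then hold strictly at \<theta>0 and persist nearby, while
  the constant depends on these fixed choices only.\<close>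

lemma error_bound:
  obtains K where "0 \<le> K" and "eventually (\<lambda>\<theta>. \<forall>\<xi>. \<exists>\<xi>'. feasible \<theta> \<xi>' \<and>
    norm (\<xi>' - \<xi>) \<le> K * (1 + norm \<xi>) * violation \<theta> \<xi>) (nhds \<theta>0)"
proof -
  obtain \<xi>s where \<xi>s: "\<And>i. i \<in> {1..m} \<Longrightarrow> ineq_residual i \<theta>0 \<xi>s < 0"
    "\<And>j. j \<in> {1..l} \<Longrightarrow> eq_residual j \<theta>0 \<xi>s = 0"
    using slater_point by blast
  have "eventually (\<lambda>\<mu>. \<mu> < - ineq_residual i \<theta>0 \<xi>s) (at_right 0)" if "i \<in> {1..m}" for i
    using \<xi>s(1)[OF that] by (intro order_tendstoD(2)[OF tendsto_ident_at]) simp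
  then have "eventually (\<lambda>\<mu>. \<forall>i\<in>{1..m}. \<mu> < - ineq_residual i \<theta>0 \<xi>s) (at_right 0)"
    by (intro eventually_ball_finite) auto
  with eventually_at_right_less[of 0]
  have "eventually (\<lambda>\<mu>. 0 < \<mu> \<and> (\<forall>i\<in>{1..m}. \<mu> < - ineq_residual i \<theta>0 \<xi>s)) (at_right 0)"
    by (rule eventually_conj)
  then obtain \<mu> :: real where \<mu>: "0 < \<mu>" "\<forall>i\<in>{1..m}. \<mu> < - ineq_residual i \<theta>0 \<xi>s"
    using eventually_happens trivial_limit_at_right_real by blast
  have "dim (span ((\<lambda>j. grad (h j) \<theta>0) ` {1..l})) = card {1..l}"
    using mfcq[of \<theta>0] by (auto simp: mfcq_qp_def)
  then obtain w where w: "\<And>j k. j \<in> {1..l} \<Longrightarrow> k \<in> {1..l} \<Longrightarrow>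
      grad (h j) \<theta>0 \<bullet> w k = (if j = k then 1 else 0)"
    using obtain_dual_family[of "{1..l}" "\<lambda>j. grad (h j) \<theta>0"] by blast
  \<comment> \<open>The summand 1 makes the bounds on the gradients strict at \<theta>0.\<close>
  define c where "c = 1 + (\<Sum>i\<in>{1..m}. norm (grad (g i) \<theta>0))"
  define W where "W = 2 * (\<Sum>j\<in>{1..l}. norm (w j))"
  define T where "T = 2 * (1 + c * W) / \<mu>"
  have c: "0 \<le> c" unfolding c_def by (simp add: sum_nonneg add_nonneg_nonneg)
  have W: "0 \<le> W" unfolding W_def by (simp add: sum_nonneg)
  have T: "0 \<le> T" unfolding T_def using c W \<mu>(1) by simp
  note id = filterlim_ident[of "nhds \<theta>0"]
  have "ineq_residual i \<theta>0 \<xi>s < - \<mu>" if "i \<in> {1..m}" for i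
    using bspec[OF \<mu>(2) that] by linarith
  then have "eventually (\<lambda>\<theta>. \<forall>i\<in>{1..m}. ineq_residual i \<theta> \<xi>s < - \<mu>) (nhds \<theta>0)"
    by (intro eventually_ball_finite ballI order_tendstoD(2)[OF tendsto_residuals(1)[OF id]]) auto
  moreover have "eventually (\<lambda>\<theta>. \<forall>i\<in>{1..m}. norm (grad (g i) \<theta>) < c) (nhds \<theta>0)"
  proof (intro eventually_ball_finite ballI)
    fix i assume i: "i \<in> {1..m}"
    have "norm (grad (g i) \<theta>0) \<le> (\<Sum>i\<in>{1..m}. norm (grad (g i) \<theta>0))"
      using i by (intro member_le_sum) auto
    then have "norm (grad (g i) \<theta>0) < c" by (simp add: c_def)
    then show "eventually (\<lambda>\<theta>. norm (grad (g i) \<theta>) < c) (nhds \<theta>0)"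
      by (rule order_tendstoD(2)[OF tendsto_norm[OF tendsto_data(3)[OF id i]]])
  qed auto
  moreover have "((\<lambda>\<theta>. \<Sum>j\<in>{1..l}. norm (grad (h j) \<theta> - grad (h j) \<theta>0) * norm (w j))
      \<longlongrightarrow> (\<Sum>j\<in>{1..l}. norm (grad (h j) \<theta>0 - grad (h j) \<theta>0) * norm (w j))) (nhds \<theta>0)"
    by (intro tendsto_sum tendsto_mult tendsto_norm tendsto_diff tendsto_const tendsto_data(5)[OF id])
  then have "eventually (\<lambda>\<theta>. (\<Sum>j\<in>{1..l}. norm (grad (h j) \<theta> - grad (h j) \<theta>0) * norm (w j)) < 1 / 2) (nhds \<theta>0)"
    by (rule order_tendstoD(2)) simp
  moreover have \<sigma>: "((\<lambda>\<theta>. \<Sum>j\<in>{1..l}. \<bar>eq_residual j \<theta> \<xi>s\<bar>) \<longlongrightarrow> (\<Sum>j\<in>{1..l}. \<bar>eq_residual j \<theta>0 \<xi>s\<bar>)) (nhds \<theta>0)"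
    by (intro tendsto_sum tendsto_rabs tendsto_residuals(2)[OF id])
  then have "eventually (\<lambda>\<theta>. (\<Sum>j\<in>{1..l}. \<bar>eq_residual j \<theta> \<xi>s\<bar>) < 1) (nhds \<theta>0)"
    by (rule order_tendstoD(2)) (simp add: \<xi>s(2)[simplified])
  moreover have "eventually (\<lambda>\<theta>. c * W * (\<Sum>j\<in>{1..l}. \<bar>eq_residual j \<theta> \<xi>s\<bar>) < \<mu> / 2) (nhds \<theta>0)"
    by (rule order_tendstoD(2)[OF tendsto_mult_left[OF \<sigma>]]) (simp add: \<xi>s(2)[simplified] \<mu>(1))
  ultimately have "eventually (\<lambda>\<theta>. \<forall>\<xi>. \<exists>\<xi>'. feasible \<theta> \<xi>' \<and>
      norm (\<xi>' - \<xi>) \<le> (T * (norm \<xi>s + W + 1) + W) * (1 + norm \<xi>) * violation \<theta> \<xi>) (nhds \<theta>0)"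
  proof eventually_elim
    case (elim \<theta>)
    show ?case
    proof (intro allI error_bound_at[OF \<mu>(1) c _ _ w _ W_def _ _ T_def])
      show "ineq_residual i \<theta> \<xi>s \<le> - \<mu>" if "i \<in> {1..m}" for i
        using bspec[OF elim(1) that] by linarith
      show "norm (grad (g i) \<theta>) \<le> c" if "i \<in> {1..m}" for i
        using bspec[OF elim(2) that] by linarith
    qed (use elim in linarith)+
  qed
  moreover have "0 \<le> T * (norm \<xi>s + W + 1) + W"
    using T W by simp
  ultimately show ?thesis using that by blast
qed

text \<open>Shows that a point feasible for \<theta> is almost feasible for \<theta>0. The residuals
  are affine in \<xi>, which is the source of the factor \<open>1 + norm \<xi>\<close>.\<close>

lemma violation_perturb:
  "violation \<theta>0 \<xi> \<le> violation \<theta> \<xi> + (1 + norm \<xi>) *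
     ((\<Sum>i\<in>{1..m}. norm (grad (g i) \<theta> - grad (g i) \<theta>0) + \<alpha> * \<bar>g i \<theta> - g i \<theta>0\<bar>)
      + (\<Sum>j\<in>{1..l}. norm (grad (h j) \<theta> - grad (h j) \<theta>0) + \<alpha> * \<bar>h j \<theta> - h j \<theta>0\<bar>))"
proof -
  have aux: "\<bar>(a' \<bullet> \<xi> + \<alpha> * b') - (a \<bullet> \<xi> + \<alpha> * b)\<bar> \<le> (1 + norm \<xi>) * (norm (a - a') + \<alpha> * \<bar>b - b'\<bar>)"
    for a a' :: "real ^ 'n" and b b'
  proof -
    have "\<bar>(a' \<bullet> \<xi> + \<alpha> * b') - (a \<bullet> \<xi> + \<alpha> * b)\<bar> = \<bar>(a - a') \<bullet> \<xi> + \<alpha> * (b - b')\<bar>"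
      by (simp add: inner_diff_left algebra_simps abs_minus_commute)
    also have "\<dots> \<le> norm (a - a') * norm \<xi> + \<alpha> * \<bar>b - b'\<bar>"
      using Cauchy_Schwarz_ineq2[of "a - a'" \<xi>] alpha_pos
      by (intro order_trans[OF abs_triangle_ineq]) (simp add: abs_mult)
    also have "\<dots> \<le> (1 + norm \<xi>) * (norm (a - a') + \<alpha> * \<bar>b - b'\<bar>)"
      using alpha_pos by (simp add: algebra_simps)
    finally show ?thesis .
  qed
  have "(\<Sum>i\<in>{1..m}. max 0 (ineq_residual i \<theta>0 \<xi>)) \<le> (\<Sum>i\<in>{1..m}. max 0 (ineq_residual i \<theta> \<xi>)
      + (1 + norm \<xi>) * (norm (grad (g i) \<theta> - grad (g i) \<theta>0) + \<alpha> * \<bar>g i \<theta> - g i \<theta>0\<bar>))"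
  proof (rule sum_mono)
    fix i
    show "max 0 (ineq_residual i \<theta>0 \<xi>) \<le> max 0 (ineq_residual i \<theta> \<xi>)
      + (1 + norm \<xi>) * (norm (grad (g i) \<theta> - grad (g i) \<theta>0) + \<alpha> * \<bar>g i \<theta> - g i \<theta>0\<bar>)"
      using aux[of "grad (g i) \<theta>0" "g i \<theta>0" "grad (g i) \<theta>" "g i \<theta>"]
      unfolding ineq_residual_def by linarith
  qed
  moreover have "(\<Sum>j\<in>{1..l}. \<bar>eq_residual j \<theta>0 \<xi>\<bar>) \<le> (\<Sum>j\<in>{1..l}. \<bar>eq_residual j \<theta> \<xi>\<bar>
      + (1 + norm \<xi>) * (norm (grad (h j) \<theta> - grad (h j) \<theta>0) + \<alpha> * \<bar>h j \<theta> - h j \<theta>0\<bar>))"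
  proof (rule sum_mono)
    fix j
    show "\<bar>eq_residual j \<theta>0 \<xi>\<bar> \<le> \<bar>eq_residual j \<theta> \<xi>\<bar>
      + (1 + norm \<xi>) * (norm (grad (h j) \<theta> - grad (h j) \<theta>0) + \<alpha> * \<bar>h j \<theta> - h j \<theta>0\<bar>)"
      using aux[of "grad (h j) \<theta>0" "h j \<theta>0" "grad (h j) \<theta>" "h j \<theta>"]
      unfolding eq_residual_def by linarith
  qed
  ultimately show ?thesis
    unfolding violation_def sum.distrib sum_distrib_left[symmetric] distrib_left by linarith
qed

end

subsection \<open>Continuity of the flow, dissipation and KKT points\<close>

context qp_mfcq
begin

text \<open>The variational inequality at \<theta> is tested near \<open>G \<theta>0\<close> and the
  one at \<theta>0 near \<open>G \<theta>\<close>, each with a point that the error bound makes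
  feasible. Together they bound the squared distance of the two minimisers by an error
  \<open>E \<theta>\<close> that tends to 0.\<close>

lemma tendsto_G: "(G \<longlongrightarrow> G \<theta>0) (nhds \<theta>0)"
proof (rule tendstoI)
  fix e :: real assume e: "0 < e"
  let ?p = "G \<theta>0" and ?H = "grad f \<theta>0"
  note id = filterlim_ident[of "nhds \<theta>0"]
  obtain K where K: "0 \<le> K" "eventually (\<lambda>\<theta>. \<forall>\<xi>. \<exists>\<xi>'. feasible \<theta> \<xi>' \<and>
      norm (\<xi>' - \<xi>) \<le> K * (1 + norm \<xi>) * violation \<theta> \<xi>) (nhds \<theta>0)"
    using error_bound by blast
  have K0: "\<exists>\<xi>'. feasible \<theta>0 \<xi>' \<and> norm (\<xi>' - \<xi>) \<le> K * (1 + norm \<xi>) * violation \<theta>0 \<xi>" for \<xi>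
    using eventually_nhds_x_imp_x[OF K(2)] by blast
  define D where "D \<theta> = (\<Sum>i\<in>{1..m}. norm (grad (g i) \<theta> - grad (g i) \<theta>0) + \<alpha> * \<bar>g i \<theta> - g i \<theta>0\<bar>)
      + (\<Sum>j\<in>{1..l}. norm (grad (h j) \<theta> - grad (h j) \<theta>0) + \<alpha> * \<bar>h j \<theta> - h j \<theta>0\<bar>)" for \<theta>
  \<comment> \<open>\<open>G \<theta>\<close> has to be bounded before its continuity is known. A
    feasible point of norm at most \<open>norm ?p + 1\<close> and
    \<open>norm (grad f \<theta>) < norm ?H + 1\<close> give \<open>norm (G \<theta> + grad f
    \<theta>) \<le> norm ?p + norm ?H + 2\<close> by the projection property; removing
    \<open>grad f \<theta>\<close> costs another \<open>norm ?H + 1\<close>.\<close>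
  define B where "B = 2 * (norm ?p + norm ?H + 2) + norm ?H + 1"
  define e1 where "e1 \<theta> = K * (1 + norm ?p) * violation \<theta> ?p" for \<theta>
  define E where "E \<theta> = (2 * B) * norm (grad f \<theta> - ?H) + B * e1 \<theta> + B * (K * (1 + B) * ((1 + B) * D \<theta>))" for \<theta>
  have "(D \<longlongrightarrow> D \<theta>0) (nhds \<theta>0)"
    unfolding D_def
    by (intro tendsto_add tendsto_sum tendsto_mult tendsto_norm tendsto_rabs tendsto_diff tendsto_const
        tendsto_data[OF id])
  moreover have "D \<theta>0 = 0" by (simp add: D_def)
  ultimately have D: "(D \<longlongrightarrow> 0) (nhds \<theta>0)" by simp
  have "(e1 \<longlongrightarrow> e1 \<theta>0) (nhds \<theta>0)"
    unfolding e1_def by (intro tendsto_mult tendsto_const tendsto_violation[OF id])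
  moreover have "e1 \<theta>0 = 0" by (simp add: e1_def violation_feasible G_feasible)
  ultimately have e1: "(e1 \<longlongrightarrow> 0) (nhds \<theta>0)" by simp
  have "(E \<longlongrightarrow> (2 * B) * norm (?H - ?H) + B * 0 + B * (K * (1 + B) * ((1 + B) * 0))) (nhds \<theta>0)"
    unfolding E_def
    by (intro tendsto_add tendsto_mult tendsto_norm tendsto_diff tendsto_const tendsto_data(1)[OF id] D e1)
  then have "eventually (\<lambda>\<theta>. E \<theta> < e\<^sup>2) (nhds \<theta>0)"
    by (rule order_tendstoD(2)) (use e in simp)
  moreover have "eventually (\<lambda>\<theta>. e1 \<theta> < 1) (nhds \<theta>0)"
    using e1 by (rule order_tendstoD(2)) simp
  moreover have "eventually (\<lambda>\<theta>. norm (grad f \<theta>) < norm ?H + 1) (nhds \<theta>0)"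
    by (rule order_tendstoD(2)[OF tendsto_norm[OF tendsto_data(1)[OF id]]]) simp
  ultimately show "eventually (\<lambda>\<theta>. dist (G \<theta>) ?p < e) (nhds \<theta>0)"
    using K(2)
  proof eventually_elim
    case (elim \<theta>)
    let ?q = "G \<theta>" and ?F = "grad f \<theta>"
    obtain \<xi>' where \<xi>': "feasible \<theta> \<xi>'" "norm (\<xi>' - ?p) \<le> e1 \<theta>"
      using elim(4) unfolding e1_def by blast
    have vi1: "0 \<le> (?q + ?F) \<bullet> (\<xi>' - ?q)"
      using \<xi>'(1) by (rule G_variational_inequality)
    have "norm \<xi>' \<le> norm ?p + 1"
      using norm_triangle_ineq2[of \<xi>' ?p] \<xi>'(2) elim(2) by linarith
    have qF: "norm (?q + ?F) \<le> norm ?p + norm ?H + 2"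
    proof -
      have "norm (?q + ?F) * norm (?q + ?F) \<le> (?q + ?F) \<bullet> (\<xi>' + ?F)"
      proof -
        have "\<xi>' - ?q = (\<xi>' + ?F) - (?q + ?F)" by simp
        with vi1 have "0 \<le> (?q + ?F) \<bullet> (\<xi>' + ?F) - (?q + ?F) \<bullet> (?q + ?F)"
          by (simp only: inner_diff_right)
        then show ?thesis
          by (simp only: diff_ge_0_iff_ge power2_norm_eq_inner[symmetric] power2_eq_square)
      qed
      also have "\<dots> \<le> norm (?q + ?F) * norm (\<xi>' + ?F)"
        by (rule norm_cauchy_schwarz)
      finally have "norm (?q + ?F) \<le> norm (\<xi>' + ?F)"
        by (cases "norm (?q + ?F) = 0") (simp_all add: mult_le_cancel_left_pos)
      then show ?thesis
        using norm_triangle_ineq[of \<xi>' ?F] \<open>norm \<xi>' \<le> norm ?p + 1\<close> elim(3) by linarith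
    qed
    have q: "norm ?q \<le> B"
    proof -
      have "norm ?q \<le> norm (?q + ?F) + norm ?F"
        using norm_triangle_ineq2[of ?q "- ?F"] by simp
      also have "\<dots> \<le> (norm ?p + norm ?H + 2) + (norm ?H + 1)"
        by (rule add_mono[OF qF less_imp_le[OF elim(3)]])
      also have "\<dots> \<le> B"
        by (simp add: B_def)
      finally show ?thesis .
    qed
    have bounds: "norm (?q + ?F) \<le> B" "norm (?p + ?H) \<le> B" "norm ?p \<le> B" "0 \<le> B"
    proof -
      have *: "norm ?p + norm ?H + 2 \<le> B" by (simp add: B_def)
      show "norm (?q + ?F) \<le> B" using qF * by (rule order_trans)
      have "norm (?p + ?H) \<le> norm ?p + norm ?H + 2"
        using norm_triangle_ineq[of ?p ?H] by simp
      then show "norm (?p + ?H) \<le> B" using * by (rule order_trans)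
      show "norm ?p \<le> B" "0 \<le> B" by (simp_all add: B_def)
    qed
    have D0: "0 \<le> D \<theta>"
      unfolding D_def using alpha_pos by (intro add_nonneg_nonneg sum_nonneg) auto
    have "violation \<theta>0 ?q \<le> (1 + norm ?q) * D \<theta>"
      using violation_perturb[of \<theta>0 ?q \<theta>] violation_feasible[OF G_feasible] unfolding D_def by simp
    also have "\<dots> \<le> (1 + B) * D \<theta>"
      using q D0 by (intro mult_right_mono) auto
    finally have viol: "violation \<theta>0 ?q \<le> (1 + B) * D \<theta>" .
    obtain p' where p': "feasible \<theta>0 p'" "norm (p' - ?q) \<le> K * (1 + norm ?q) * violation \<theta>0 ?q"
      using K0 by blast
    have "K * (1 + norm ?q) * violation \<theta>0 ?q \<le> K * (1 + B) * ((1 + B) * D \<theta>)"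
      using viol q K(1) bounds(4) by (intro mult_mono) (auto simp: violation_nonneg)
    with p'(2) have p'_le: "norm (p' - ?q) \<le> K * (1 + B) * ((1 + B) * D \<theta>)"
      by linarith
    have vi2: "0 \<le> (?p + ?H) \<bullet> (p' - ?p)"
      using p'(1) by (rule G_variational_inequality)
    have "(?q + ?F) \<bullet> (\<xi>' - ?p) \<le> B * e1 \<theta>"
      using norm_cauchy_schwarz[of "?q + ?F" "\<xi>' - ?p"]
        mult_mono[OF bounds(1) \<xi>'(2) bounds(4) norm_ge_zero] by linarith
    moreover have "(?p + ?H) \<bullet> (p' - ?q) \<le> B * (K * (1 + B) * ((1 + B) * D \<theta>))"
      using norm_cauchy_schwarz[of "?p + ?H" "p' - ?q"]
        mult_mono[OF bounds(2) p'_le bounds(4) norm_ge_zero] by linarith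
    moreover have "(?F - ?H) \<bullet> (?p - ?q) \<le> (2 * B) * norm (?F - ?H)"
    proof -
      have "norm (?p - ?q) \<le> 2 * B"
        using norm_triangle_ineq4[of ?p ?q] q bounds(3) by linarith
      then show ?thesis
        using norm_cauchy_schwarz[of "?F - ?H" "?p - ?q"]
          mult_left_mono[of "norm (?p - ?q)" "2 * B" "norm (?F - ?H)"] by (simp add: mult.commute)
    qed
    \<comment> \<open>The two subtracted products are nonnegative by the variational inequalities;
      the first three are the small errors collected in \<open>E \<theta>\<close>.\<close>
    moreover have "(norm (?q - ?p))\<^sup>2 = (?F - ?H) \<bullet> (?p - ?q) + (?q + ?F) \<bullet> (\<xi>' - ?p)
        + (?p + ?H) \<bullet> (p' - ?q) - (?q + ?F) \<bullet> (\<xi>' - ?q) - (?p + ?H) \<bullet> (p' - ?p)"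
      unfolding power2_norm_eq_inner
      by (simp add: inner_diff_left inner_diff_right inner_add_left inner_add_right inner_commute)
    ultimately have "(norm (?q - ?p))\<^sup>2 \<le> E \<theta>"
      using vi1 vi2 unfolding E_def by linarith
    then have "(norm (?q - ?p))\<^sup>2 < e\<^sup>2" using elim(1) by linarith
    then show ?case
      using e unfolding dist_norm by (rule power_less_imp_less_base[OF _ less_imp_le])
  qed
qed

lemma continuous_on_G: "continuous_on S G"
  unfolding continuous_on_def
proof
  fix x
  have "at x within S \<le> nhds x" by (simp add: at_within_def)
  then show "(G \<longlongrightarrow> G x) (at x within S)" using tendsto_G by (rule tendsto_mono)
qed

text \<open>If 0 were feasible, it could be used as test point and the inequality would hold without
  the violation term. The error bound at 0 supplies a feasible substitute of norm at most
  \<open>K * violation \<theta> 0\<close>, and Cauchy-Schwarz turns this norm into the extra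
  term.\<close>

lemma dissipation_locally:
  "\<exists>K. eventually (\<lambda>\<theta>. grad f \<theta> \<bullet> G \<theta> \<le> - (norm (G \<theta>))\<^sup>2 + K * violation \<theta> 0) (nhds \<theta>0)"
proof -
  obtain K where K: "0 \<le> K" "eventually (\<lambda>\<theta>. \<forall>\<xi>. \<exists>\<xi>'. feasible \<theta> \<xi>' \<and>
      norm (\<xi>' - \<xi>) \<le> K * (1 + norm \<xi>) * violation \<theta> \<xi>) (nhds \<theta>0)"
    using error_bound by blast
  define N where "N = norm (G \<theta>0 + grad f \<theta>0) + 1"
  have "((\<lambda>\<theta>. norm (G \<theta> + grad f \<theta>)) \<longlongrightarrow> norm (G \<theta>0 + grad f \<theta>0)) (nhds \<theta>0)"
    by (intro tendsto_norm tendsto_add tendsto_G tendsto_data filterlim_ident)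
  then have "eventually (\<lambda>\<theta>. norm (G \<theta> + grad f \<theta>) < N) (nhds \<theta>0)"
    by (rule order_tendstoD(2)) (simp add: N_def)
  with K(2) have "eventually (\<lambda>\<theta>. grad f \<theta> \<bullet> G \<theta> \<le> - (norm (G \<theta>))\<^sup>2 + (N * K) * violation \<theta> 0) (nhds \<theta>0)"
  proof eventually_elim
    case (elim \<theta>)
    obtain \<xi> where \<xi>: "feasible \<theta> \<xi>" "norm \<xi> \<le> K * violation \<theta> 0"
      using spec[OF elim(1), of 0] by auto
    have "(G \<theta> + grad f \<theta>) \<bullet> \<xi> \<le> N * (K * violation \<theta> 0)"
      using norm_cauchy_schwarz[of "G \<theta> + grad f \<theta>" \<xi>]
        mult_mono[OF less_imp_le[OF elim(2)] \<xi>(2) _ norm_ge_zero] elim(2)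
        order_trans[OF norm_ge_zero less_imp_le[OF elim(2)]] by linarith
    with G_variational_inequality[OF \<xi>(1)] show ?case
      unfolding power2_norm_eq_inner by (simp add: inner_diff_right inner_add_left)
  qed
  then show ?thesis by blast
qed

lemma dissipation_on_compact:
  assumes "compact C"
  obtains K where "0 \<le> K"
    "\<And>\<theta>. \<theta> \<in> C \<Longrightarrow> grad f \<theta> \<bullet> G \<theta> \<le> - (norm (G \<theta>))\<^sup>2 + K * violation \<theta> 0"
proof (rule compact_uniform_constant[OF assms dissipation_locally])
  fix K L \<theta> assume "grad f \<theta> \<bullet> G \<theta> \<le> - (norm (G \<theta>))\<^sup>2 + K * violation \<theta> 0" "K \<le> L"
  moreover have "K * violation \<theta> 0 \<le> L * violation \<theta> 0"
    using \<open>K \<le> L\<close> violation_nonneg by (rule mult_right_mono)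
  ultimately show "grad f \<theta> \<bullet> G \<theta> \<le> - (norm (G \<theta>))\<^sup>2 + L * violation \<theta> 0"
    by linarith
qed (use that in blast)

text \<open>Complementarity is imposed index by index instead of restricting the sum to active
  constraints, so that membership directly yields multipliers as in \<open>kkt\<close>.\<close>

definition multiplier_cone :: "real ^ 'n \<Rightarrow> (real ^ 'n) set" where
  "multiplier_cone \<theta> = {(\<Sum>i\<in>{1..m}. u i *\<^sub>R grad (g i) \<theta>) + (\<Sum>j\<in>{1..l}. v j *\<^sub>R grad (h j) \<theta>) | u v.
     \<forall>i\<in>{1..m}. 0 \<le> u i \<and> u i * g i \<theta> = 0}"

lemma convex_cone_multiplier_cone: "convex_cone (multiplier_cone \<theta>)"
  unfolding convex_cone_iff
proof (intro conjI ballI allI impI)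
  show "0 \<in> multiplier_cone \<theta>"
    unfolding multiplier_cone_def by (auto intro!: exI[of _ "\<lambda>_. 0"])
next
  fix x y assume "x \<in> multiplier_cone \<theta>" "y \<in> multiplier_cone \<theta>"
  then obtain u v u' v' where
    x: "x = (\<Sum>i\<in>{1..m}. u i *\<^sub>R grad (g i) \<theta>) + (\<Sum>j\<in>{1..l}. v j *\<^sub>R grad (h j) \<theta>)"
      "\<forall>i\<in>{1..m}. 0 \<le> u i \<and> u i * g i \<theta> = 0" and
    y: "y = (\<Sum>i\<in>{1..m}. u' i *\<^sub>R grad (g i) \<theta>) + (\<Sum>j\<in>{1..l}. v' j *\<^sub>R grad (h j) \<theta>)"
      "\<forall>i\<in>{1..m}. 0 \<le> u' i \<and> u' i * g i \<theta> = 0"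
    unfolding multiplier_cone_def by blast
  have "x + y = (\<Sum>i\<in>{1..m}. (u i + u' i) *\<^sub>R grad (g i) \<theta>) + (\<Sum>j\<in>{1..l}. (v j + v' j) *\<^sub>R grad (h j) \<theta>)"
    unfolding x(1) y(1) by (simp add: scaleR_add_left sum.distrib)
  moreover have "\<forall>i\<in>{1..m}. 0 \<le> u i + u' i \<and> (u i + u' i) * g i \<theta> = 0"
    using x(2) y(2) by (auto simp: distrib_right)
  ultimately show "x + y \<in> multiplier_cone \<theta>"
    unfolding multiplier_cone_def mem_Collect_eq
    by (intro exI[of _ "\<lambda>i. u i + u' i"] exI[of _ "\<lambda>j. v j + v' j"] conjI)
next
  fix x and c :: real assume "x \<in> multiplier_cone \<theta>" "0 \<le> c"
  then obtain u v where
    x: "x = (\<Sum>i\<in>{1..m}. u i *\<^sub>R grad (g i) \<theta>) + (\<Sum>j\<in>{1..l}. v j *\<^sub>R grad (h j) \<theta>)"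
      "\<forall>i\<in>{1..m}. 0 \<le> u i \<and> u i * g i \<theta> = 0"
    unfolding multiplier_cone_def by blast
  have "c *\<^sub>R x = (\<Sum>i\<in>{1..m}. (c * u i) *\<^sub>R grad (g i) \<theta>) + (\<Sum>j\<in>{1..l}. (c * v j) *\<^sub>R grad (h j) \<theta>)"
    unfolding x(1) by (simp add: scaleR_add_right scaleR_sum_right)
  moreover have "\<forall>i\<in>{1..m}. 0 \<le> c * u i \<and> c * u i * g i \<theta> = 0"
    using x(2) \<open>0 \<le> c\<close> by simp
  ultimately show "c *\<^sub>R x \<in> multiplier_cone \<theta>"
    unfolding multiplier_cone_def mem_Collect_eq
    by (intro exI[of _ "\<lambda>i. c * u i"] exI[of _ "\<lambda>j. c * v j"] conjI)
qed

lemma multiplier_cone_generators: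
  "i \<in> {1..m} \<Longrightarrow> g i \<theta> = 0 \<Longrightarrow> grad (g i) \<theta> \<in> multiplier_cone \<theta>"
  "j \<in> {1..l} \<Longrightarrow> c *\<^sub>R grad (h j) \<theta> \<in> multiplier_cone \<theta>"
proof -
  assume i: "i \<in> {1..m}" "g i \<theta> = 0"
  have "(\<Sum>k\<in>{1..m}. (if k = i then 1 else 0) *\<^sub>R grad (g k) \<theta>) = (\<Sum>k\<in>{1..m}. if k = i then grad (g k) \<theta> else 0)"
    by (intro sum.cong) auto
  then have "grad (g i) \<theta> = (\<Sum>k\<in>{1..m}. (if k = i then 1 else 0) *\<^sub>R grad (g k) \<theta>)
      + (\<Sum>k\<in>{1..l}. 0 *\<^sub>R grad (h k) \<theta>)"
    using i(1) by simp
  then show "grad (g i) \<theta> \<in> multiplier_cone \<theta>"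
    unfolding multiplier_cone_def mem_Collect_eq using i(2)
    by (intro exI[of _ "\<lambda>k. if k = i then 1 else 0"] exI[of _ "\<lambda>_. 0"] conjI) auto
next
  assume j: "j \<in> {1..l}"
  have "(\<Sum>k\<in>{1..l}. (if k = j then c else 0) *\<^sub>R grad (h k) \<theta>) = (\<Sum>k\<in>{1..l}. if k = j then c *\<^sub>R grad (h k) \<theta> else 0)"
    by (intro sum.cong) auto
  then have "c *\<^sub>R grad (h j) \<theta> = (\<Sum>k\<in>{1..m}. 0 *\<^sub>R grad (g k) \<theta>)
      + (\<Sum>k\<in>{1..l}. (if k = j then c else 0) *\<^sub>R grad (h k) \<theta>)"
    using j by simp
  then show "c *\<^sub>R grad (h j) \<theta> \<in> multiplier_cone \<theta>"
    unfolding multiplier_cone_def mem_Collect_eq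
    by (intro exI[of _ "\<lambda>_. 0"] exI[of _ "\<lambda>k. if k = j then c else 0"] conjI) auto
qed

text \<open>Farkas' lemma: if \<open>- grad f \<theta>\<close> could be separated from the cone of the active constraints, the
  separating direction would be a feasible descent direction of (QP) at its minimiser \<open>0\<close>.\<close>

lemma kkt_if_G_zero:
  assumes G0: "G \<theta> = 0"
  shows "\<exists>u v. kkt f m g l h \<theta> u v"
proof -
  have "feasible \<theta> 0" using G_feasible[of \<theta>] G0 by simp
  then have g_le: "\<forall>i\<in>{1..m}. g i \<theta> \<le> 0" and h_eq: "\<forall>j\<in>{1..l}. h j \<theta> = 0"
    using alpha_pos by (auto simp: feasible_iff ineq_residual_def eq_residual_def mult_le_0_iff)
  have descent: "0 \<le> grad f \<theta> \<bullet> \<xi>" if "feasible \<theta> \<xi>" for \<xi>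
    using G_variational_inequality[OF that] G0 by simp
  \<comment> \<open>Finitely many generators make the cone closed, as separation requires; both
    signs of the equality gradients make the separating direction orthogonal to them.\<close>
  define S where "S = (\<lambda>i. grad (g i) \<theta>) ` {i\<in>{1..m}. g i \<theta> = 0}
      \<union> (\<lambda>j. 1 *\<^sub>R grad (h j) \<theta>) ` {1..l} \<union> (\<lambda>j. (-1) *\<^sub>R grad (h j) \<theta>) ` {1..l}"
  have "finite S" by (simp add: S_def)
  then have closed: "closed (convex_cone hull S)" by (rule closed_convex_cone_hull)
  have "- grad f \<theta> \<in> convex_cone hull S"
  proof (rule ccontr)
    assume "- grad f \<theta> \<notin> convex_cone hull S"
    then obtain a b where ab: "a \<bullet> (- grad f \<theta>) < b" "\<And>x. x \<in> convex_cone hull S \<Longrightarrow> b < a \<bullet> x"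
      using separating_hyperplane_closed_point[OF convex_convex_cone_hull closed] by blast
    have b: "b < 0" using ab(2)[OF convex_cone_hull_contains_0] by simp
    have nonneg: "0 \<le> a \<bullet> s" if s: "s \<in> S" for s
    proof (rule ccontr)
      assume neg: "\<not> 0 \<le> a \<bullet> s"
      \<comment> \<open>The factor is positive and scales \<open>s\<close> so that its inner product
        with \<open>a\<close> is exactly \<open>b\<close>, against the strict separation.\<close>
      have "(b / (a \<bullet> s)) *\<^sub>R s \<in> convex_cone hull S"
        using s b neg by (intro convex_cone_hull_mul hull_inc) (auto simp: divide_nonpos_nonpos)
      from ab(2)[OF this] neg show False by simp
    qed
    let ?d = "- a"
    have dg: "grad (g i) \<theta> \<bullet> ?d \<le> 0" if "i \<in> {1..m}" "g i \<theta> = 0" for i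
      using nonneg[of "grad (g i) \<theta>"] that by (auto simp: S_def inner_commute)
    have dh: "grad (h j) \<theta> \<bullet> ?d = 0" if "j \<in> {1..l}" for j
      using nonneg[of "1 *\<^sub>R grad (h j) \<theta>"] nonneg[of "(-1) *\<^sub>R grad (h j) \<theta>"] that
      by (force simp: S_def inner_commute)
    have df: "grad f \<theta> \<bullet> ?d < 0"
      using ab(1) b by (simp add: inner_commute)
    have "eventually (\<lambda>\<epsilon>. ineq_residual i \<theta> (\<epsilon> *\<^sub>R ?d) \<le> 0) (at_right 0)" if i: "i \<in> {1..m}" for i
    proof (cases "g i \<theta> = 0")
      case True
      have "ineq_residual i \<theta> (\<epsilon> *\<^sub>R ?d) \<le> 0" if "0 < \<epsilon>" for \<epsilon>
        using mult_nonneg_nonpos[OF less_imp_le[OF that] dg[OF i True]] True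
        by (simp add: ineq_residual_def)
      then show ?thesis by (rule eventually_mono[OF eventually_at_right_less])
    next
      case False
      then have "g i \<theta> < 0" using g_le i by force
      then have "ineq_residual i \<theta> (0 *\<^sub>R ?d) < 0"
        using alpha_pos by (simp add: ineq_residual_def mult_pos_neg)
      moreover have "((\<lambda>\<epsilon>. ineq_residual i \<theta> (\<epsilon> *\<^sub>R ?d)) \<longlongrightarrow> ineq_residual i \<theta> (0 *\<^sub>R ?d)) (at_right 0)"
        unfolding ineq_residual_def by (intro tendsto_intros)
      ultimately have "eventually (\<lambda>\<epsilon>. ineq_residual i \<theta> (\<epsilon> *\<^sub>R ?d) < 0) (at_right 0)"
        by (rule order_tendstoD(2)[rotated])
      then show ?thesis by (rule eventually_mono) simp
    qed
    then have "eventually (\<lambda>\<epsilon>. \<forall>i\<in>{1..m}. ineq_residual i \<theta> (\<epsilon> *\<^sub>R ?d) \<le> 0) (at_right 0)"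
      by (intro eventually_ball_finite) auto
    with eventually_at_right_less[of 0]
    have "eventually (\<lambda>\<epsilon>. 0 < \<epsilon> \<and> (\<forall>i\<in>{1..m}. ineq_residual i \<theta> (\<epsilon> *\<^sub>R ?d) \<le> 0)) (at_right 0)"
      by (rule eventually_conj)
    then obtain \<epsilon> :: real where \<epsilon>: "0 < \<epsilon>" "\<forall>i\<in>{1..m}. ineq_residual i \<theta> (\<epsilon> *\<^sub>R ?d) \<le> 0"
      using eventually_happens trivial_limit_at_right_real by blast
    have "feasible \<theta> (\<epsilon> *\<^sub>R ?d)"
      using \<epsilon>(2) dh h_eq by (simp add: feasible_iff eq_residual_def)
    from descent[OF this] mult_pos_neg[OF \<epsilon>(1) df] show False
      by simp
  qed
  moreover have "convex_cone hull S \<subseteq> multiplier_cone \<theta>"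
    using convex_cone_multiplier_cone
    by (intro hull_minimal) (auto simp only: S_def intro!: multiplier_cone_generators)
  ultimately obtain u v where
    uv: "- grad f \<theta> = (\<Sum>i\<in>{1..m}. u i *\<^sub>R grad (g i) \<theta>) + (\<Sum>j\<in>{1..l}. v j *\<^sub>R grad (h j) \<theta>)"
      "\<forall>i\<in>{1..m}. 0 \<le> u i \<and> u i * g i \<theta> = 0"
    unfolding multiplier_cone_def by blast
  have "grad f \<theta> + (\<Sum>i\<in>{1..m}. u i *\<^sub>R grad (g i) \<theta>) + (\<Sum>j\<in>{1..l}. v j *\<^sub>R grad (h j) \<theta>) = 0"
    unfolding add.assoc uv(1)[symmetric] by simp
  moreover have "(\<Sum>i\<in>{1..m}. u i * g i \<theta>) = 0"
    using uv(2) by (intro sum.neutral) auto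
  ultimately have "kkt f m g l h \<theta> u v"
    unfolding kkt_def using uv(2) g_le h_eq by blast
  then show ?thesis by blast
qed

text \<open>At a KKT point 0 is feasible for (QP) and can be used as test point. Pairing
  stationarity with \<open>G \<theta>\<close>, which obeys the linearised constraints, then bounds
  \<open>G \<theta> \<bullet> G \<theta>\<close> by a multiple of the complementarity sum, which is
  0.\<close>

lemma G_zero_if_kkt:
  assumes "kkt f m g l h \<theta> u v"
  shows "G \<theta> = 0"
proof -
  have stat: "grad f \<theta> + (\<Sum>i\<in>{1..m}. u i *\<^sub>R grad (g i) \<theta>) + (\<Sum>j\<in>{1..l}. v j *\<^sub>R grad (h j) \<theta>) = 0"
    and g: "\<forall>i\<in>{1..m}. g i \<theta> \<le> 0" and h: "\<forall>j\<in>{1..l}. h j \<theta> = 0"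
    and u: "\<forall>i\<in>{1..m}. 0 \<le> u i" and comp: "(\<Sum>i\<in>{1..m}. u i * g i \<theta>) = 0"
    using assms by (auto simp: kkt_def)
  have "feasible \<theta> 0"
    using g h alpha_pos by (auto simp: feasible_iff ineq_residual_def eq_residual_def mult_nonneg_nonpos)
  then have "0 \<le> (G \<theta> + grad f \<theta>) \<bullet> (0 - G \<theta>)"
    by (rule G_variational_inequality)
  then have "G \<theta> \<bullet> G \<theta> \<le> - (grad f \<theta> \<bullet> G \<theta>)"
    by (simp add: inner_add_left)
  also have "- (grad f \<theta> \<bullet> G \<theta>) = (\<Sum>i\<in>{1..m}. u i * (grad (g i) \<theta> \<bullet> G \<theta>)) + (\<Sum>j\<in>{1..l}. v j * (grad (h j) \<theta> \<bullet> G \<theta>))"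
  proof -
    have "(grad f \<theta> + (\<Sum>i\<in>{1..m}. u i *\<^sub>R grad (g i) \<theta>) + (\<Sum>j\<in>{1..l}. v j *\<^sub>R grad (h j) \<theta>)) \<bullet> G \<theta> = 0"
      unfolding stat by simp
    then show ?thesis by (simp add: inner_add_left inner_sum_left)
  qed
  also have "(\<Sum>j\<in>{1..l}. v j * (grad (h j) \<theta> \<bullet> G \<theta>)) = 0"
    using G_feasible[of \<theta>] h by (intro sum.neutral) (simp add: qp_feasible_def)
  also have "(\<Sum>i\<in>{1..m}. u i * (grad (g i) \<theta> \<bullet> G \<theta>)) \<le> (\<Sum>i\<in>{1..m}. u i * (- \<alpha> * g i \<theta>))"
    using G_feasible[of \<theta>] u by (intro sum_mono mult_left_mono) (auto simp: qp_feasible_def)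
  also have "(\<Sum>i\<in>{1..m}. u i * (- \<alpha> * g i \<theta>)) = - \<alpha> * (\<Sum>i\<in>{1..m}. u i * g i \<theta>)"
    by (simp add: sum_distrib_left mult_ac sum_negf)
  finally have "G \<theta> \<bullet> G \<theta> \<le> 0" using comp by simp
  then show ?thesis using inner_gt_zero_iff[of "G \<theta>"] by linarith
qed

end

subsection \<open>Stability and convergence\<close>

context qp_mfcq
begin

section \<open>Decay of the constraints and of the Lyapunov function along trajectories\<close>

lemma ineq_residual_0 [simp]: "ineq_residual i \<theta> 0 = \<alpha> * g i \<theta>"
  and eq_residual_0 [simp]: "eq_residual j \<theta> 0 = \<alpha> * h j \<theta>"
  by (simp_all add: ineq_residual_def eq_residual_def)

lemma violation_0_eq_0_iff: "violation \<theta> 0 = 0 \<longleftrightarrow> nlp_feasible m g l h \<theta>"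
proof
  assume v: "violation \<theta> 0 = 0"
  have "g i \<theta> \<le> 0" if "i \<in> {1..m}" for i
    using ineq_residual_le_violation[OF that, of \<theta> 0] v alpha_pos by (simp add: mult_le_0_iff)
  moreover have "h j \<theta> = 0" if "j \<in> {1..l}" for j
  proof -
    have "\<bar>eq_residual j \<theta> 0\<bar> \<le> (\<Sum>j\<in>{1..l}. \<bar>eq_residual j \<theta> 0\<bar>)"
      using that by (intro member_le_sum) auto
    with eq_residual_sum_le_violation[of \<theta> 0] v have "\<bar>eq_residual j \<theta> 0\<bar> \<le> 0" by linarith
    then show ?thesis using alpha_pos by simp
  qed
  ultimately show "nlp_feasible m g l h \<theta>" by (simp add: nlp_feasible_def)
next
  assume "nlp_feasible m g l h \<theta>"
  then have "feasible \<theta> 0"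
    using alpha_pos by (simp add: nlp_feasible_def feasible_iff mult_nonneg_nonpos)
  then show "violation \<theta> 0 = 0" by (rule violation_feasible)
qed

text \<open>Along a trajectory the constraints of (QP) at \<open>G (x t)\<close> are a differential
  inequality for \<open>g i\<close> and a differential equation for \<open>h j\<close>, both with
  rate \<alpha>. Equality for \<open>h j\<close> comes from the decay lemma with both signs.\<close>

lemma constraint_decay:
  assumes x: "ode_solution G {0..b} x" and b: "0 \<le> b"
  shows "i \<in> {1..m} \<Longrightarrow> g i (x b) \<le> exp (- \<alpha> * b) * g i (x 0)"
    and "j \<in> {1..l} \<Longrightarrow> h j (x b) = exp (- \<alpha> * b) * h j (x 0)"
proof -
  assume i: "i \<in> {1..m}"
  show "g i (x b) \<le> exp (- \<alpha> * b) * g i (x 0)"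
    using b
  proof (rule exponential_decay[where \<phi> = "\<lambda>t. g i (x t)" and \<phi>' = "\<lambda>t. grad (g i) (x t) \<bullet> G (x t)"])
    fix r assume r: "r \<in> {0..b}"
    show "((\<lambda>t. g i (x t)) has_real_derivative grad (g i) (x r) \<bullet> G (x r)) (at r within {0..b})"
      by (rule has_real_derivative_along_solution[OF g_smooth[OF i] x r])
    show "grad (g i) (x r) \<bullet> G (x r) \<le> - \<alpha> * g i (x r)"
      using G_feasible[of "x r"] i by (simp add: qp_feasible_def)
  qed
next
  assume j: "j \<in> {1..l}"
  have der: "((\<lambda>t. h j (x t)) has_real_derivative - \<alpha> * h j (x r)) (at r within {0..b})"
    if "r \<in> {0..b}" for r
    using has_real_derivative_along_solution[OF h_smooth[OF j] x that] G_feasible[of "x r"] j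
    by (simp add: qp_feasible_def)
  have "h j (x b) \<le> exp (- \<alpha> * b) * h j (x 0)"
    by (rule exponential_decay[where \<phi> = "\<lambda>t. h j (x t)", OF b der]) simp_all
  moreover have "- h j (x b) \<le> exp (- \<alpha> * b) * (- h j (x 0))"
    by (rule exponential_decay[where \<phi> = "\<lambda>t. - h j (x t)", OF b DERIV_minus[OF der]]) simp_all
  ultimately show "h j (x b) = exp (- \<alpha> * b) * h j (x 0)" by simp
qed

lemma violation_decay:
  assumes x: "ode_solution G {0..b} x" and b: "0 \<le> b"
  shows "violation (x b) 0 \<le> exp (- \<alpha> * b) * violation (x 0) 0"
proof -
  have "(\<Sum>i\<in>{1..m}. max 0 (\<alpha> * g i (x b))) \<le> (\<Sum>i\<in>{1..m}. exp (- \<alpha> * b) * max 0 (\<alpha> * g i (x 0)))"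
  proof (rule sum_mono)
    fix i assume i: "i \<in> {1..m}"
    have "\<alpha> * g i (x b) \<le> \<alpha> * (exp (- \<alpha> * b) * g i (x 0))"
      using constraint_decay(1)[OF x b i] alpha_pos by (intro mult_left_mono) auto
    also have "\<dots> = exp (- \<alpha> * b) * (\<alpha> * g i (x 0))" by (simp add: mult_ac)
    also have "\<dots> \<le> exp (- \<alpha> * b) * max 0 (\<alpha> * g i (x 0))"
      by (intro mult_left_mono) auto
    finally show "max 0 (\<alpha> * g i (x b)) \<le> exp (- \<alpha> * b) * max 0 (\<alpha> * g i (x 0))"
      by simp
  qed
  moreover have "(\<Sum>j\<in>{1..l}. \<bar>\<alpha> * h j (x b)\<bar>) = (\<Sum>j\<in>{1..l}. exp (- \<alpha> * b) * \<bar>\<alpha> * h j (x 0)\<bar>)"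
    using constraint_decay(2)[OF x b] by (intro sum.cong) (simp_all add: abs_mult)
  ultimately show ?thesis
    unfolding violation_def ineq_residual_0 eq_residual_0 distrib_left sum_distrib_left by linarith
qed

text \<open>The decay factor is at most 1, so it preserves upper bounds that are nonnegative;
  negative constraint values may grow, but not beyond 0.\<close>

lemma constraint_sublevel_invariant:
  assumes x: "ode_solution G {0..b} x" and b: "0 \<le> b"
    and bars: "\<forall>i\<in>{1..m}. 0 \<le> gbar i" "\<forall>j\<in>{1..l}. 0 \<le> hbar j"
    and x0: "x 0 \<in> constraint_sublevel m g l h gbar hbar"
  shows "x b \<in> constraint_sublevel m g l h gbar hbar"
proof -
  have e: "exp (- \<alpha> * b) \<le> 1" "0 \<le> exp (- \<alpha> * b)"
    using alpha_pos b by simp_all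
  have shrink: "exp (- \<alpha> * b) * y \<le> z" if "y \<le> z" "0 \<le> z" for y z :: real
    using mult_left_mono[OF that(1) e(2)] mult_right_mono[OF e(1) that(2)] by linarith
  have "g i (x b) \<le> gbar i" if i: "i \<in> {1..m}" for i
    using constraint_decay(1)[OF x b i] shrink[of "g i (x 0)" "gbar i"] x0 bars i
    by (fastforce simp: constraint_sublevel_def)
  moreover have "\<bar>h j (x b)\<bar> \<le> hbar j" if j: "j \<in> {1..l}" for j
    using constraint_decay(2)[OF x b j] shrink[of "\<bar>h j (x 0)\<bar>" "hbar j"] x0 bars j
    by (simp add: constraint_sublevel_def abs_mult)
  ultimately show ?thesis by (simp add: constraint_sublevel_def)
qed

text \<open>Along a trajectory, \<open>f\<close> need not decrease, but the possible increase is paid for by the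
  exponentially decaying constraint violation.\<close>

lemma lyapunov_decrease:
  assumes x: "ode_solution G {0..t} x" and st: "0 \<le> s" "s \<le> t" and K: "0 \<le> K"
    and diss: "\<And>r. r \<in> {s..t} \<Longrightarrow>
      grad f (x r) \<bullet> G (x r) \<le> - (norm (G (x r)))\<^sup>2 + K * violation (x r) 0"
    and c: "\<And>r. r \<in> {s..t} \<Longrightarrow> c \<le> (norm (G (x r)))\<^sup>2"
  shows "f (x t) + K / \<alpha> * violation (x 0) 0 * exp (- \<alpha> * t) + c * (t - s)
       \<le> f (x s) + K / \<alpha> * violation (x 0) 0 * exp (- \<alpha> * s)"
proof -
  let ?V = "violation (x 0) 0"
  \<comment> \<open>The coefficient \<open>K / \<alpha>\<close> makes the derivative of the
    exponential term \<open>- K * ?V * exp (- \<alpha> * r)\<close>, which outweighs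
    \<open>K * violation (x r) 0\<close> in \<open>diss\<close>; \<open>c * r\<close> records the
    guaranteed rate of decrease.\<close>
  let ?\<psi> = "\<lambda>r. f (x r) + K / \<alpha> * ?V * exp (- \<alpha> * r) + c * r"
  have "?\<psi> t \<le> ?\<psi> s"
  proof (rule nonincreasing_if_derivative_nonpos[where \<psi> = ?\<psi>
        and \<psi>' = "\<lambda>r. grad f (x r) \<bullet> G (x r) - K * ?V * exp (- \<alpha> * r) + c", OF st(2)])
    fix r assume r: "r \<in> {s..t}"
    have x': "ode_solution G {s..t} x" using ode_solution_subset[OF x] st by auto
    have fx: "((\<lambda>r. f (x r)) has_real_derivative grad f (x r) \<bullet> G (x r)) (at r within {s..t})"
      by (rule has_real_derivative_along_solution[OF f_smooth x' r])
    have ex: "((\<lambda>r. K / \<alpha> * ?V * exp (- \<alpha> * r)) has_real_derivative - (K * ?V * exp (- \<alpha> * r)))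
        (at r within {s..t})"
      using alpha_pos by (auto intro!: derivative_eq_intros)
    show "(?\<psi> has_real_derivative grad f (x r) \<bullet> G (x r) - K * ?V * exp (- \<alpha> * r) + c) (at r within {s..t})"
      using DERIV_add[OF DERIV_add[OF fx ex] DERIV_cmult_Id[of c r "{s..t}"]] by simp
    have "violation (x r) 0 \<le> exp (- \<alpha> * r) * ?V"
      using r st by (intro violation_decay ode_solution_subset[OF x]) auto
    then have "K * violation (x r) 0 \<le> K * ?V * exp (- \<alpha> * r)"
      using mult_left_mono[of "violation (x r) 0" "exp (- \<alpha> * r) * ?V" K] K by (simp add: mult_ac)
    with diss[OF r] c[OF r] show "grad f (x r) \<bullet> G (x r) - K * ?V * exp (- \<alpha> * r) + c \<le> 0"
      by linarith
  qed
  then show ?thesis by (simp add: algebra_simps)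
qed

end

section \<open>Global asymptotic stability of the unique KKT point\<close>

locale safe_gradient_system = qp_mfcq f g h m l \<alpha>
  for f :: "real ^ 'n \<Rightarrow> real" and g h :: "nat \<Rightarrow> real ^ 'n \<Rightarrow> real" and m l :: nat and \<alpha> :: real +
  fixes \<theta>star :: "real ^ 'n"
  assumes solution_iff: "\<And>\<theta>. nlp_solution f m g l h \<theta> \<longleftrightarrow> \<theta> = \<theta>star"
    and kkt_iff: "\<And>\<theta>. (\<exists>u v. kkt f m g l h \<theta> u v) \<longleftrightarrow> \<theta> = \<theta>star"
    and sublevel: "\<And>\<theta>. \<exists>gbar hbar.
        (\<forall>i\<in>{1..m}. gbar i \<ge> 0) \<and> (\<forall>j\<in>{1..l}. hbar j \<ge> 0) \<and>
        compact (constraint_sublevel m g l h gbar hbar) \<and>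
        \<theta> \<in> constraint_sublevel m g l h gbar hbar"
begin

lemma G_eq_0_iff: "G \<theta> = 0 \<longleftrightarrow> \<theta> = \<theta>star"
  using kkt_if_G_zero G_zero_if_kkt kkt_iff by blast

lemma compact_invariant_set:
  "\<exists>C. compact C \<and> x0 \<in> C \<and> (\<forall>b y. 0 \<le> b \<longrightarrow> ode_solution G {0..b} y \<longrightarrow> y 0 = x0 \<longrightarrow> y b \<in> C)"
proof -
  obtain gbar hbar where bars: "\<forall>i\<in>{1..m}. 0 \<le> gbar i" "\<forall>j\<in>{1..l}. 0 \<le> hbar j"
    and C: "compact (constraint_sublevel m g l h gbar hbar)" "x0 \<in> constraint_sublevel m g l h gbar hbar"
    using sublevel[of x0] by blast
  have "y b \<in> constraint_sublevel m g l h gbar hbar"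
    if "0 \<le> b" "ode_solution G {0..b} y" "y 0 = x0" for b y
    using constraint_sublevel_invariant[OF that(2,1) bars] that(3) C(2) by simp
  with C show ?thesis by blast
qed

lemma solution_exists: "\<exists>x. ode_solution G {0..} x \<and> x 0 = x0"
proof -
  obtain C where C: "compact C" "x0 \<in> C"
    "\<And>b y. 0 \<le> b \<Longrightarrow> ode_solution G {0..b} y \<Longrightarrow> y 0 = x0 \<Longrightarrow> y b \<in> C"
    using compact_invariant_set[of x0] by auto
  show ?thesis
    using continuous_on_G C(1,2) by (rule ode_solution_exists_in_compact) (rule C(3))
qed

text \<open>Away from \<theta>star the dissipation is at least \<open>c\<close>. Since the speed is
  at most \<open>B\<close>, a trajectory found at distance \<open>e\<close> or more stays outside
  the ball of radius \<open>e / 2\<close> for time \<open>\<tau> = e / (2 * B)\<close> and lowers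
  \<open>W\<close> by \<open>c * \<tau>\<close>. As \<open>W\<close> is nonincreasing and bounded
  below, this cannot happen at arbitrarily late times.\<close>

lemma converges:
  assumes x: "ode_solution G {0..} x"
  shows "(x \<longlongrightarrow> \<theta>star) at_top"
proof (rule tendstoI)
  fix e :: real assume e: "0 < e"
  obtain C where C: "compact C"
    "\<And>b y. 0 \<le> b \<Longrightarrow> ode_solution G {0..b} y \<Longrightarrow> y 0 = x 0 \<Longrightarrow> y b \<in> C"
    using compact_invariant_set[of "x 0"] by auto
  have xb: "ode_solution G {0..b} x" for b
    using x by (rule ode_solution_subset) auto
  have x_C: "x t \<in> C" if "0 \<le> t" for t
    using C(2)[OF that xb] by simp
  have "C \<noteq> {}" using x_C[of 0] by auto
  obtain K where K: "0 \<le> K" "\<And>\<theta>. \<theta> \<in> C \<Longrightarrow>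
      grad f \<theta> \<bullet> G \<theta> \<le> - (norm (G \<theta>))\<^sup>2 + K * violation \<theta> 0"
    using dissipation_on_compact[OF C(1)] by blast
  have "continuous_on C f"
    using diff_loc_lipschitz_deriv_continuous_on(1)[OF f_smooth] by (rule continuous_on_subset) simp
  then obtain y0 where y0: "\<And>y. y \<in> C \<Longrightarrow> f y0 \<le> f y"
    using continuous_attains_inf[OF C(1) \<open>C \<noteq> {}\<close>] by metis
  have "continuous_on C (\<lambda>y. norm (G y))"
    by (intro continuous_on_norm continuous_on_G)
  then obtain y1 where y1: "\<And>y. y \<in> C \<Longrightarrow> norm (G y) \<le> norm (G y1)"
    using continuous_attains_sup[OF C(1) \<open>C \<noteq> {}\<close>] by metis
  define B where "B = norm (G y1) + 1"
  have B: "0 < B" "\<And>y. y \<in> C \<Longrightarrow> norm (G y) \<le> B"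
    using y1 by (auto simp: B_def add_nonneg_pos add_increasing2)
  define C' where "C' = C - ball \<theta>star (e / 2)"
  obtain c where c: "0 < c" "\<And>y. y \<in> C' \<Longrightarrow> c \<le> (norm (G y))\<^sup>2"
  proof (cases "C' = {}")
    case True
    then show ?thesis using that[of 1] by simp
  next
    case False
    have "compact C'" unfolding C'_def by (intro compact_diff C(1) open_ball)
    moreover have "continuous_on C' (\<lambda>y. (norm (G y))\<^sup>2)"
      by (intro continuous_on_power continuous_on_norm continuous_on_G)
    ultimately obtain y2 where y2: "y2 \<in> C'" "\<forall>y\<in>C'. (norm (G y2))\<^sup>2 \<le> (norm (G y))\<^sup>2"
      using continuous_attains_inf[of C'] False by blast
    have "y2 \<noteq> \<theta>star" using y2(1) e by (auto simp: C'_def)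
    then have "0 < (norm (G y2))\<^sup>2" by (simp add: G_eq_0_iff)
    then show ?thesis using that y2(2) by blast
  qed
  define W where "W t = f (x t) + K / \<alpha> * violation (x 0) 0 * exp (- \<alpha> * t)" for t
  have W_decr: "W t + c0 * (t - s) \<le> W s"
    if "0 \<le> s" "s \<le> t" "\<And>r. r \<in> {s..t} \<Longrightarrow> c0 \<le> (norm (G (x r)))\<^sup>2" for s t c0
    unfolding W_def using that K x_C by (intro lyapunov_decrease[OF xb]) auto
  have W_lower: "f y0 \<le> W t" if "0 \<le> t" for t
  proof -
    have "0 \<le> K / \<alpha> * violation (x 0) 0 * exp (- \<alpha> * t)"
      using K(1) alpha_pos violation_nonneg by simp
    then show ?thesis using y0[OF x_C[OF that]] unfolding W_def by linarith
  qed
  define \<tau> where "\<tau> = e / (2 * B)"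
  have \<tau>: "0 < \<tau>" "\<tau> * B = e / 2" using e B(1) by (simp_all add: \<tau>_def)
  have drop: "W (t + \<tau>) + c * \<tau> \<le> W t" if t: "0 \<le> t" "e \<le> dist (x t) \<theta>star" for t
  proof -
    have "c \<le> (norm (G (x r)))\<^sup>2" if r: "r \<in> {t..t + \<tau>}" for r
    proof -
      have "norm (x r - x t - (r - t) *\<^sub>R 0) \<le> (r - t) * B"
      proof (rule has_vector_derivative_linear_bound[where x' = "\<lambda>q. G (x q)"])
        fix q assume q: "q \<in> {t..r}"
        have "ode_solution G {t..r} x"
          by (rule ode_solution_subset[OF x]) (use t in auto)
        then show "(x has_vector_derivative G (x q)) (at q within {t..r})"
          using q by (simp add: ode_solution_def)
        show "norm (G (x q) - 0) \<le> B"
          using B(2)[OF x_C, of q] q t by simp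
      qed (use r in auto)
      also have "(r - t) * B \<le> \<tau> * B"
        using r B(1) by (intro mult_right_mono) auto
      finally have "dist (x r) (x t) \<le> e / 2"
        using \<tau>(2) by (simp add: dist_norm)
      moreover have "dist (x t) \<theta>star \<le> dist (x r) (x t) + dist (x r) \<theta>star"
        by (metis dist_commute dist_triangle)
      ultimately have "e / 2 \<le> dist (x r) \<theta>star" using t(2) by linarith
      then have "x r \<in> C'"
        using x_C[of r] r t by (simp add: C'_def dist_commute)
      then show ?thesis by (rule c(2))
    qed
    then show ?thesis
      using W_decr[of t "t + \<tau>" c] t(1) \<tau>(1) by simp
  qed
  have bdd: "bdd_below (W ` {0..})"
    using W_lower by (intro bdd_belowI[of _ "f y0"]) auto
  \<comment> \<open>From \<open>t0\<close> on, \<open>W\<close> exceeds its infimum by less than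
    \<open>c * \<tau>\<close>, so no further drop of that size is possible.\<close>
  have "Inf (W ` {0..}) < Inf (W ` {0..}) + c * \<tau>" using c(1) \<tau>(1) by simp
  then obtain t0 where t0: "0 \<le> t0" "W t0 < Inf (W ` {0..}) + c * \<tau>"
    using cInf_lessD[of "W ` {0..}" "Inf (W ` {0..}) + c * \<tau>"] by auto
  have "dist (x t) \<theta>star < e" if t: "t0 \<le> t" for t
  proof (rule ccontr)
    assume "\<not> dist (x t) \<theta>star < e"
    then have "W (t + \<tau>) + c * \<tau> \<le> W t" using drop[of t] t t0(1) by simp
    moreover have "W t \<le> W t0" using W_decr[of t0 t 0] t t0(1) by simp
    moreover have "Inf (W ` {0..}) \<le> W (t + \<tau>)"
      using bdd t t0(1) \<tau>(1) by (intro cInf_lower) auto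
    ultimately show False using t0(2) by linarith
  qed
  then show "eventually (\<lambda>t. dist (x t) \<theta>star < e) at_top"
    unfolding eventually_at_top_linorder by blast
qed

lemma star_feasible: "violation \<theta>star 0 = 0"
  using solution_iff[of \<theta>star] by (simp add: violation_0_eq_0_iff nlp_solution_def is_arg_min_def)

text \<open>\<theta>star minimises \<open>f\<close> only among feasible points, so \<open>f\<close>
  may be smaller at infeasible ones, but there the violation is positive. If both terms vanished,
  \<theta> would be a second solution of (NLP).\<close>

lemma penalty_pos:
  assumes "\<theta> \<noteq> \<theta>star"
  shows "0 < max 0 (f \<theta> - f \<theta>star) + violation \<theta> 0"
proof (rule ccontr)
  assume "\<not> ?thesis"
  then have v: "violation \<theta> 0 = 0" and f: "f \<theta> \<le> f \<theta>star"
    using violation_nonneg[of \<theta> 0] by linarith+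
  have "\<not> f y < f \<theta>" if "nlp_feasible m g l h y" for y
  proof -
    have "\<not> f y < f \<theta>star"
      using solution_iff[of \<theta>star] that by (auto simp: nlp_solution_def is_arg_min_def)
    then show ?thesis using f by linarith
  qed
  then have "nlp_solution f m g l h \<theta>"
    using v by (auto simp: nlp_solution_def is_arg_min_def violation_0_eq_0_iff)
  then show False using assms solution_iff by simp
qed

text \<open>A trajectory leaving the ball has to meet the sphere, where \<open>\<Phi>\<close> is at
  least \<eta>. Until then it lies in the closed ball on which \<open>K\<close> is valid, so
  \<open>f\<close> and the violation at the exit are controlled by their values at the
  start.\<close>

lemma stable:
  assumes e: "0 < e"
  obtains \<delta> where "0 < \<delta>"
    "\<And>x t. ode_solution G {0..} x \<Longrightarrow> dist (x 0) \<theta>star < \<delta> \<Longrightarrow> 0 \<le> t \<Longrightarrow> dist (x t) \<theta>star < e"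
proof -
  obtain K where K: "0 \<le> K" "\<And>\<theta>. \<theta> \<in> cball \<theta>star e \<Longrightarrow>
      grad f \<theta> \<bullet> G \<theta> \<le> - (norm (G \<theta>))\<^sup>2 + K * violation \<theta> 0"
    using dissipation_on_compact[OF compact_cball] by blast
  \<comment> \<open>\<open>\<Phi>\<close> is evaluated at the exit point and \<open>\<Psi>\<close>
    at the starting point; the extra \<open>K / \<alpha> * violation \<theta> 0\<close> in
    \<open>\<Psi>\<close> bounds the total increase of \<open>f\<close> that
    \<open>lyapunov_decrease\<close> permits.\<close>
  define \<Phi> where "\<Phi> \<theta> = max 0 (f \<theta> - f \<theta>star) + violation \<theta> 0" for \<theta>
  define \<Psi> where "\<Psi> \<theta> = max 0 (f \<theta> - f \<theta>star + K / \<alpha> * violation \<theta> 0) + violation \<theta> 0" for \<theta>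
  have f_tendsto: "((\<lambda>\<theta>. f \<theta>) \<longlongrightarrow> f \<theta>0) (at \<theta>0 within A)" for \<theta>0 A
    using diff_loc_lipschitz_deriv_continuous_on(1)[OF f_smooth]
    by (metis UNIV_I continuous_on_def subset_UNIV tendsto_within_subset)
  obtain \<eta> where \<eta>: "0 < \<eta>" "\<And>\<theta>. \<theta> \<in> sphere \<theta>star e \<Longrightarrow> \<eta> \<le> \<Phi> \<theta>"
  proof (cases "sphere \<theta>star e = {}")
    case True
    then show ?thesis using that[of 1] by simp
  next
    case False
    have "continuous_on (sphere \<theta>star e) \<Phi>"
      unfolding continuous_on_def \<Phi>_def
      by (intro ballI tendsto_add tendsto_max tendsto_diff tendsto_const f_tendsto
          tendsto_violation tendsto_ident_at)
    then obtain \<theta>1 where \<theta>1: "\<theta>1 \<in> sphere \<theta>star e" "\<forall>\<theta>\<in>sphere \<theta>star e. \<Phi> \<theta>1 \<le> \<Phi> \<theta>"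
      using continuous_attains_inf[OF compact_sphere False] by blast
    have "\<theta>1 \<noteq> \<theta>star" using \<theta>1(1) e by auto
    then have "0 < \<Phi> \<theta>1" unfolding \<Phi>_def by (rule penalty_pos)
    then show ?thesis using that \<theta>1(2) by blast
  qed
  have "(\<Psi> \<longlongrightarrow> \<Psi> \<theta>star) (at \<theta>star)"
    unfolding \<Psi>_def
    by (intro tendsto_add tendsto_max tendsto_diff tendsto_mult tendsto_const f_tendsto
        tendsto_violation tendsto_ident_at)
  moreover have \<Psi>0: "\<Psi> \<theta>star = 0" by (simp add: \<Psi>_def star_feasible)
  ultimately have "eventually (\<lambda>\<theta>. \<Psi> \<theta> < \<eta>) (at \<theta>star)"
    using \<eta>(1) by (intro order_tendstoD(2)) auto
  then obtain \<delta> where \<delta>: "0 < \<delta>" "\<forall>\<theta>. \<theta> \<noteq> \<theta>star \<and> dist \<theta> \<theta>star < \<delta> \<longrightarrow> \<Psi> \<theta> < \<eta>"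
    unfolding eventually_at by auto
  have near: "\<Psi> \<theta> < \<eta>" if "dist \<theta> \<theta>star < \<delta>" for \<theta>
    using \<delta>(2) \<Psi>0 \<eta>(1) that by (cases "\<theta> = \<theta>star") auto
  \<comment> \<open>The minimum with \<open>e\<close> makes the trajectory start strictly inside the
    sphere, as \<open>first_hitting_time\<close> requires.\<close>
  have "dist (x t) \<theta>star < e"
    if x: "ode_solution G {0..} x" and x0: "dist (x 0) \<theta>star < min \<delta> e" and t: "0 \<le> t" for x t
  proof (rule ccontr)
    assume far: "\<not> dist (x t) \<theta>star < e"
    have "continuous_on {0..t} x"
      using ode_solution_continuous_on[OF x] by (rule continuous_on_subset) auto
    then have "continuous_on {0..t} (\<lambda>r. dist (x r) \<theta>star)"
      by (intro continuous_on_dist continuous_on_const)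
    then obtain s where s: "s \<in> {0..t}" "dist (x s) \<theta>star = e"
      "\<And>r. r \<in> {0..s} \<Longrightarrow> dist (x r) \<theta>star \<le> e"
      using first_hitting_time[of t "\<lambda>r. dist (x r) \<theta>star" e] t x0 far by auto
    have xs: "ode_solution G {0..s} x" and s0: "0 \<le> s"
      using ode_solution_subset[OF x] s(1) by auto
    let ?V = "violation (x 0) 0"
    have "f (x s) + K / \<alpha> * ?V * exp (- \<alpha> * s) + 0 * (s - 0) \<le> f (x 0) + K / \<alpha> * ?V * exp (- \<alpha> * 0)"
      using s0 K s(3) by (intro lyapunov_decrease[OF xs]) (auto simp: dist_commute)
    moreover have "0 \<le> K / \<alpha> * ?V * exp (- \<alpha> * s)"
      using K(1) alpha_pos violation_nonneg by simp
    ultimately have "f (x s) \<le> f (x 0) + K / \<alpha> * ?V" by simp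
    moreover have "violation (x s) 0 \<le> ?V"
    proof -
      have "exp (- \<alpha> * s) \<le> 1" using alpha_pos s0 by simp
      from mult_right_mono[OF this violation_nonneg] violation_decay[OF xs s0]
      show ?thesis by (metis mult_1 order_trans)
    qed
    ultimately have "\<Phi> (x s) \<le> \<Psi> (x 0)"
      unfolding \<Phi>_def \<Psi>_def by (intro add_mono max.mono) auto
    moreover have "\<eta> \<le> \<Phi> (x s)" using \<eta>(2)[of "x s"] s(2) by (simp add: dist_commute)
    moreover have "\<Psi> (x 0) < \<eta>" using near x0 by simp
    ultimately show False by linarith
  qed
  moreover have "0 < min \<delta> e" using \<delta>(1) e by simp
  ultimately show ?thesis using that by blast
qed

theorem G_globally_asymptotically_stable: "globally_asymptotically_stable G \<theta>star"
  unfolding globally_asymptotically_stable_def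
proof (intro conjI allI impI)
  show "G \<theta>star = 0" by (simp add: G_eq_0_iff)
  show "\<exists>x. ode_solution G {0..} x \<and> x 0 = x0" for x0 by (rule solution_exists)
  show "\<exists>y. ode_solution G {0..} y \<and> (\<forall>t\<in>{0..<T}. y t = x t)"
    if "0 < T" "ode_solution G {0..<T} x" for T x
    by (rule ode_solution_extends_in_compact[OF continuous_on_G compact_invariant_set that(2,1)])
  show "\<exists>\<delta>>0. \<forall>x. ode_solution G {0..} x \<and> dist (x 0) \<theta>star < \<delta> \<longrightarrow> (\<forall>t\<ge>0. dist (x t) \<theta>star < \<epsilon>)"
    if "0 < \<epsilon>" for \<epsilon>
    using stable[OF that] by metis
  show "(x \<longlongrightarrow> \<theta>star) at_top" if "ode_solution G {0..} x" for x
    using that by (rule converges)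
qed

end

theorem theorem3:
  fixes f :: "real ^ 'n \<Rightarrow> real"
    and g h :: "nat \<Rightarrow> real ^ 'n \<Rightarrow> real"
    and m l :: nat
    and \<alpha> :: real
    and \<theta>star :: "real ^ 'n"
  assumes f_smooth: "diff_loc_lipschitz_deriv f"
    and g_smooth: "\<And>i. i \<in> {1..m} \<Longrightarrow> diff_loc_lipschitz_deriv (g i)"
    and h_smooth: "\<And>j. j \<in> {1..l} \<Longrightarrow> diff_loc_lipschitz_deriv (h j)"
    and alpha_pos: "\<alpha> > 0"
    and A1: "\<And>\<theta>. mfcq_qp \<alpha> f m g l h \<theta>"
    and A2_solution: "\<And>\<theta>. nlp_solution f m g l h \<theta> \<longleftrightarrow> \<theta> = \<theta>star"
    and A2_kkt: "\<And>\<theta>. (\<exists>u v. kkt f m g l h \<theta> u v) \<longleftrightarrow> \<theta> = \<theta>star"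
    and A3: "\<And>\<theta>. \<exists>gbar hbar.
        (\<forall>i\<in>{1..m}. gbar i \<ge> 0) \<and> (\<forall>j\<in>{1..l}. hbar j \<ge> 0) \<and>
        compact (constraint_sublevel m g l h gbar hbar) \<and>
        \<theta> \<in> constraint_sublevel m g l h gbar hbar"
  shows "globally_asymptotically_stable (safe_gradient_flow \<alpha> f m g l h) \<theta>star"
proof -
  interpret safe_gradient_system f g h m l \<alpha> \<theta>star
    by unfold_locales (fact f_smooth g_smooth h_smooth alpha_pos A1 A2_solution A2_kkt A3)+
  show ?thesis by (rule G_globally_asymptotically_stable)
qed

end
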